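(* Let $U_-<U_+$ be real numbers, $U=[U_-,U_+]$, and let $b\in C^3(U)$ satisfy $b^*\ge b(u)\ge b_*>0$ for all $u\in U$, with constants $b^*,b_*$. Let $\ell\ge 1$ be a fixed integer, $\alpha>0$ and $c\ge 1$ constants. For $0<\varepsilon\ll 1$ let $u_\varepsilon$ be the solution, with values in $U$, of $$\varepsilon^2u''+x\,b(u)\,u'=0,\quad x\in[0,1],\qquad u(0)=U_-,\ u(1)=U_+,$$ let $u_\varepsilon^h=[u_\varepsilon(x_1),\ldots,u_\varepsilon(x_{N-1})]^T$ be its restriction to the interior points of the S($\ell$) mesh with $\lambda=N$ (see context), and let $w_\varepsilon^h\in W$ be the solution of the discrete problem $Tw^h=0$ on this mesh (see context). Then there exist $\varepsilon_0\in(0,1)$, $\eta>0$ and $M>0$, depending only on $b,U_-,U_+,b_*,b^*,\alpha,\ell,c$ (in particular $\eta$ and $M$ are independent of $\varepsilon$ and $N$), such that for all $\varepsilon\in(0,\varepsilon_0]$ and all such meshes $$\|w_\varepsilon^h-u_\varepsilon^h\|_H\le M\left(\delta+N^{-(1+\eta\ln N)}\right),\qquad \delta=\varepsilon\left(\frac{\ln^{\ell}N}{N}\right)^2 ,$$ where $\ln^\ell$ denotes the $\ell$-fold iterated logarithm.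
   Context: **Continuous solution.** $u_\varepsilon\in C^2([0,1])$ is the unique solution of the boundary value problem satisfying $u_\varepsilon(x)\in U$ for all $x\in[0,1]$. **S($\ell$) mesh.** Let $\ln^0\lambda=\lambda$, $\ln^k\lambda=\ln(\ln^{k-1}\lambda)$ (iterated logarithm, not a power), $k=1,\ldots,K$, where $K=K(\lambda)$ is the positive integer with $0<\ln^K\lambda<1$; it is assumed that $1\le\ell\le K$. The transition points are $\tau_k=\alpha\varepsilon\ln^{\ell-k+1}\lambda$, $k=1,\ldots,\ell$, with $\tau_\ell<1$ assumed; put $\tau_0=0$, $\tau_{\ell+1}=1$. Each interval $I_k=[\tau_{k-1},\tau_k]$, $k=1,\ldots,\ell+1$, is divided into $N_k\ge2$ equal subintervals, where $N_1+\cdots+N_{\ell+1}=N$ and $N\le cN_k$ for every $k$, with $c$ independent of $\varepsilon$ and $N$. The resulting points $0=x_0<x_1<\cdots<x_N=1$ form the mesh. Let $h_i=x_i-x_{i-1}$; the meshes satisfy $h_i\le h_{i+1}$, $i=1,\ldots,N-1$. Here $\lambda=N$. **Discrete problem.** Let $\hbar_i=(h_i+h_{i+1})/2$. Mesh functions $w^h=[w_1,\ldots,w_{N-1}]^T\in\mathbb R^{N-1}$ are extended by $w_0=U_-$, $w_N=U_+$, and $W=\{w^h\in\mathbb R^{N-1}: w_i\in U,\ i=1,\ldots,N-1\}$. Let $\rho_i=b^*x_{i-1}h_i/(2\varepsilon^2)$ and $n=\max\{i\in\{1,\ldots,N-1\}:\rho_i\le1\}$ (note $\rho_1=0$). If $1<n<N-1$,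 set $\chi_i=\hbar_i$ for $1\le i\le n-1$, $\chi_n=h_n/2+h_{n+1}$, $\chi_i=h_{i+1}$ for $n+1\le i\le N-1$. If $n=1$, set $\chi_i=h_{i+1}$ for all $i$; if $n=N-1$, set $\chi_i=\hbar_i$ for all $i$. Let $f(x,u)=x\int_{U_+}^u b(t)\,dt$, $f_x(x,u)=\int_{U_+}^u b(t)\,dt$, $f_i=f(x_i,w_i)$, $f_{x,i}=f_x(x_i,w_i)$, and $$D''w_i=\frac1{\chi_i}\left(\frac{w_{i-1}-w_i}{h_i}+\frac{w_{i+1}-w_i}{h_{i+1}}\right),$$ $$T_cw_i=-\varepsilon^2D''w_i-\frac{f_{i+1}-f_{i-1}}{2\hbar_i}+f_{x,i},$$ $$T_+w_i=-\varepsilon^2D''w_i-\frac{f_{i+1}-f_i}{h_{i+1}}+\frac{f_{x,i+1}+f_{x,i}}2,$$ $$T_tw_i=-\varepsilon^2D''w_i-\frac{2f_{i+1}-f_i-f_{i-1}}{2\chi_i}+f_{x,i}.$$ If $1<n<N-1$: $(Tw^h)_i=T_cw_i$ for $1\le i\le n-1$, $(Tw^h)_n=T_tw_n$, $(Tw^h)_i=T_+w_i$ for $n+1\le i\le N-1$. If $n=1$, $T=T_+$ at all $i$; if $n=N-1$, $T=T_c$ at all $i$. The discrete problem is $Tw^h=0$. **Norm.** $\|w^h\|_H=\sum_{i=1}^{N-1}\chi_i|w_i|$. *)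

theory Defs
  imports "HOL-Analysis.Analysis"
begin

text \<open>One-sided derivatives are used at the end points of a closed interval \<open>S\<close>.\<close>

primrec C_k_on :: "nat \<Rightarrow> (real \<Rightarrow> real) \<Rightarrow> real set \<Rightarrow> bool" where
  "C_k_on 0 g S \<longleftrightarrow> continuous_on S g"
| "C_k_on (Suc k) g S \<longleftrightarrow>
     (\<exists>g'. (\<forall>x\<in>S. (g has_real_derivative g' x) (at x within S)) \<and> C_k_on k g' S)"

definition bvp_solution ::
  "(real \<Rightarrow> real) \<Rightarrow> real \<Rightarrow> real \<Rightarrow> real \<Rightarrow> (real \<Rightarrow> real) \<Rightarrow> bool" where
  "bvp_solution b U_lo U_hi \<epsilon> u \<longleftrightarrow>
     (\<exists>u' u''.
        (\<forall>x\<in>{0..1}. (u has_real_derivative u' x) (at x within {0..1})) \<and>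
        (\<forall>x\<in>{0..1}. (u' has_real_derivative u'' x) (at x within {0..1})) \<and>
        continuous_on {0..1} u'' \<and>
        (\<forall>x\<in>{0..1}. \<epsilon>\<^sup>2 * u'' x + x * b (u x) * u' x = 0)) \<and>
     u 0 = U_lo \<and> u 1 = U_hi \<and>
     (\<forall>x\<in>{0..1}. u x \<in> {U_lo..U_hi})"

definition iter_ln :: "nat \<Rightarrow> real \<Rightarrow> real" where
  "iter_ln k = (ln :: real \<Rightarrow> real) ^^ k"

text \<open>\<open>iter_ln_depth lam K\<close> says that \<open>K = K(lam)\<close>, the positive integer for which the
  \<open>K\<close>-fold iterated logarithm of \<open>lam\<close> lies in \<open>(0, 1)\<close>. As \<open>ln\<close> is a total function
  here, positivity of the earlier iterates is required so that only genuine logarithms are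
  taken; this makes \<open>K\<close> unique.\<close>

definition iter_ln_depth :: "real \<Rightarrow> nat \<Rightarrow> bool" where
  "iter_ln_depth lam K \<longleftrightarrow>
     1 \<le> K \<and> (\<forall>j<K. 0 < iter_ln j lam) \<and> 0 < iter_ln K lam \<and> iter_ln K lam < 1"

definition transition_point :: "real \<Rightarrow> nat \<Rightarrow> real \<Rightarrow> real \<Rightarrow> nat \<Rightarrow> real" where
  "transition_point \<alpha> l \<epsilon> lam k =
     (if k = 0 then 0
      else if k \<le> l then \<alpha> * \<epsilon> * iter_ln (l - k + 1) lam
      else 1)"

definition step :: "(nat \<Rightarrow> real) \<Rightarrow> nat \<Rightarrow> real" where
  "step x i = x i - x (i - 1)"

text \<open>\<open>S_mesh \<alpha> l c \<epsilon> N x\<close>: the points \<open>x 0, \<dots>, x N\<close> form an S(\<open>l\<close>) mesh with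
  \<open>\<lambda> = N\<close>; \<open>Ns k\<close> is the number of subintervals of the \<open>k\<close>-th piece. The last
  condition is the assumed monotonicity of the steps.\<close>

definition S_mesh :: "real \<Rightarrow> nat \<Rightarrow> real \<Rightarrow> real \<Rightarrow> nat \<Rightarrow> (nat \<Rightarrow> real) \<Rightarrow> bool" where
  "S_mesh \<alpha> l c \<epsilon> N x \<longleftrightarrow>
     (\<exists>K. iter_ln_depth (real N) K \<and> 1 \<le> l \<and> l \<le> K) \<and>
     transition_point \<alpha> l \<epsilon> (real N) l < 1 \<and>
     (\<exists>Ns :: nat \<Rightarrow> nat.
        (\<forall>k\<in>{1..l+1}. 2 \<le> Ns k \<and> real N \<le> c * real (Ns k)) \<and>
        (\<Sum>k=1..l+1. Ns k) = N \<and>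
        (\<forall>k\<in>{1..l+1}. \<forall>j\<le>Ns k.
           x ((\<Sum>m=1..<k. Ns m) + j) =
             transition_point \<alpha> l \<epsilon> (real N) (k - 1) +
             real j * (transition_point \<alpha> l \<epsilon> (real N) k
                       - transition_point \<alpha> l \<epsilon> (real N) (k - 1)) / real (Ns k))) \<and>
     (\<forall>i\<in>{1..N-1}. step x i \<le> step x (i + 1))"

definition avg_step :: "(nat \<Rightarrow> real) \<Rightarrow> nat \<Rightarrow> real" where
  "avg_step x i = (step x i + step x (i + 1)) / 2"

definition mesh_ratio :: "real \<Rightarrow> real \<Rightarrow> (nat \<Rightarrow> real) \<Rightarrow> nat \<Rightarrow> real" where
  "mesh_ratio b_hi \<epsilon> x i = b_hi * x (i - 1) * step x i / (2 * \<epsilon>\<^sup>2)"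

definition switch_index :: "real \<Rightarrow> real \<Rightarrow> nat \<Rightarrow> (nat \<Rightarrow> real) \<Rightarrow> nat" where
  "switch_index b_hi \<epsilon> N x = Max {i \<in> {1..N-1}. mesh_ratio b_hi \<epsilon> x i \<le> 1}"

text \<open>In the following, \<open>n\<close> stands for the switching index. The clauses \<open>n = 1\<close> and
  \<open>n = N - 1\<close> exclude each other, as an S(\<open>l\<close>) mesh has \<open>N \<ge> 4\<close>.\<close>

definition chi :: "nat \<Rightarrow> nat \<Rightarrow> (nat \<Rightarrow> real) \<Rightarrow> nat \<Rightarrow> real" where
  "chi n N x i =
     (if n = 1 then step x (i + 1)
      else if n = N - 1 then avg_step x i
      else if i < n then avg_step x i
      else if i = n then step x n / 2 + step x (n + 1)
      else step x (i + 1))"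

definition flux_x :: "(real \<Rightarrow> real) \<Rightarrow> real \<Rightarrow> real \<Rightarrow> real \<Rightarrow> real" where
  "flux_x b U_hi y v = (LBINT t=ereal U_hi..ereal v. b t)"

definition flux :: "(real \<Rightarrow> real) \<Rightarrow> real \<Rightarrow> real \<Rightarrow> real \<Rightarrow> real" where
  "flux b U_hi y v = y * (LBINT t=ereal U_hi..ereal v. b t)"

definition D2 :: "nat \<Rightarrow> nat \<Rightarrow> (nat \<Rightarrow> real) \<Rightarrow> (nat \<Rightarrow> real) \<Rightarrow> nat \<Rightarrow> real" where
  "D2 n N x w i =
     1 / chi n N x i *
       ((w (i - 1) - w i) / step x i + (w (i + 1) - w i) / step x (i + 1))"

definition T_central ::
  "(real \<Rightarrow> real) \<Rightarrow> real \<Rightarrow> real \<Rightarrow> nat \<Rightarrow> nat \<Rightarrow> (nat \<Rightarrow> real) \<Rightarrow> (nat \<Rightarrow> real) \<Rightarrow> nat \<Rightarrow> real" where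
  "T_central b U_hi \<epsilon> n N x w i =
     - (\<epsilon>\<^sup>2) * D2 n N x w i
     - (flux b U_hi (x (i + 1)) (w (i + 1)) - flux b U_hi (x (i - 1)) (w (i - 1)))
         / (2 * avg_step x i)
     + flux_x b U_hi (x i) (w i)"

definition T_plus ::
  "(real \<Rightarrow> real) \<Rightarrow> real \<Rightarrow> real \<Rightarrow> nat \<Rightarrow> nat \<Rightarrow> (nat \<Rightarrow> real) \<Rightarrow> (nat \<Rightarrow> real) \<Rightarrow> nat \<Rightarrow> real" where
  "T_plus b U_hi \<epsilon> n N x w i =
     - (\<epsilon>\<^sup>2) * D2 n N x w i
     - (flux b U_hi (x (i + 1)) (w (i + 1)) - flux b U_hi (x i) (w i)) / step x (i + 1)
     + (flux_x b U_hi (x (i + 1)) (w (i + 1)) + flux_x b U_hi (x i) (w i)) / 2"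

definition T_transition ::
  "(real \<Rightarrow> real) \<Rightarrow> real \<Rightarrow> real \<Rightarrow> nat \<Rightarrow> nat \<Rightarrow> (nat \<Rightarrow> real) \<Rightarrow> (nat \<Rightarrow> real) \<Rightarrow> nat \<Rightarrow> real" where
  "T_transition b U_hi \<epsilon> n N x w i =
     - (\<epsilon>\<^sup>2) * D2 n N x w i
     - (2 * flux b U_hi (x (i + 1)) (w (i + 1)) - flux b U_hi (x i) (w i)
          - flux b U_hi (x (i - 1)) (w (i - 1))) / (2 * chi n N x i)
     + flux_x b U_hi (x i) (w i)"

definition T_op ::
  "(real \<Rightarrow> real) \<Rightarrow> real \<Rightarrow> real \<Rightarrow> nat \<Rightarrow> nat \<Rightarrow> (nat \<Rightarrow> real) \<Rightarrow> (nat \<Rightarrow> real) \<Rightarrow> nat \<Rightarrow> real" where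
  "T_op b U_hi \<epsilon> n N x w i =
     (if n = 1 then T_plus b U_hi \<epsilon> n N x w i
      else if n = N - 1 then T_central b U_hi \<epsilon> n N x w i
      else if i < n then T_central b U_hi \<epsilon> n N x w i
      else if i = n then T_transition b U_hi \<epsilon> n N x w i
      else T_plus b U_hi \<epsilon> n N x w i)"

text \<open>A mesh function is a map \<open>w\<close> of which only \<open>w 1, \<dots>, w (N - 1)\<close> and the boundary
  values \<open>w 0\<close>, \<open>w N\<close> matter.\<close>

definition discrete_solution ::
  "(real \<Rightarrow> real) \<Rightarrow> real \<Rightarrow> real \<Rightarrow> real \<Rightarrow> real \<Rightarrow> nat \<Rightarrow> (nat \<Rightarrow> real) \<Rightarrow> (nat \<Rightarrow> real) \<Rightarrow> bool" where
  "discrete_solution b U_lo U_hi b_hi \<epsilon> N x w \<longleftrightarrow>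
     w 0 = U_lo \<and> w N = U_hi \<and>
     (\<forall>i\<in>{1..N-1}. w i \<in> {U_lo..U_hi}) \<and>
     (\<forall>i\<in>{1..N-1}. T_op b U_hi \<epsilon> (switch_index b_hi \<epsilon> N x) N x w i = 0)"

definition norm_H :: "nat \<Rightarrow> nat \<Rightarrow> (nat \<Rightarrow> real) \<Rightarrow> (nat \<Rightarrow> real) \<Rightarrow> real" where
  "norm_H n N x w = (\<Sum>i=1..N-1. chi n N x i * \<bar>w i\<bar>)"

end

theory Submission
  imports Defs
begin

text \<open>
  In the layer variable \<open>t = x / \<epsilon>\<close> the solution \<open>v\<close> satisfies \<open>v'' = - t b(v) v'\<close>, so \<open>v'\<close> decays like
  \<open>exp (- b_lo t\<^sup>2 / 2)\<close>, and the derivatives up to order four of \<open>v\<close> are bounded, uniformly in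
  \<open>\<epsilon>\<close>, by any decaying exponential.

  Stability is an \<open>L\<^sup>1\<close> argument: each scheme, multiplied by \<open>chi\<close>, is a conservative tridiagonal
  system in the differences \<open>w - u\<close> whose column sums are at least \<open>b_lo * chi / 2\<close>. The only
  exception is the last column when all rows are central; slightly growing row weights near
  \<open>x = 1\<close> repair it.

  For consistency, the step that follows \<open>t\<close> inside the layer is at most
  \<open>const * (ln\<^sup>l N / N) * exp (2 t / \<alpha>)\<close>, because consecutive transition points are related by an
  exponential; the decay of the derivatives absorbs the factor \<open>exp (2 t / \<alpha>)\<close>. So rows in the
  interior of a mesh piece contribute a Riemann sum of \<open>(ln\<^sup>l N / N)\<^sup>2 * exp (- t)\<close>, and each of the at
  most \<open>l\<close> junction rows, where one order is lost, a single term of the same size. In the rows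
  beyond the last transition point \<open>t \<ge> \<alpha> * ln N / 2\<close>, and everything is of order
  \<open>exp (- const * (ln N)\<^sup>2)\<close>.
\<close>

text \<open>All constants have to be fixed from \<open>b\<close>, the range of values, \<alpha>,
  \<open>c\<close> and \<open>l\<close> before \<epsilon> and \<open>N\<close> enter. The factor
  \<epsilon> in front of the algebraic term is pure scaling: a central row multiplied by
  \<open>chi\<close> is \<epsilon> times its counterpart in the variable \<open>t\<close>. Rows from
  the outermost transition point onwards are not expanded at all. They are small term by term,
  because the primitive \<open>F\<close> of \<open>b\<close> is normalised to vanish at
  \<open>U_hi\<close>. Their size is exp (- 2 \<eta> (ln N)^2); half of this exponent is kept for
  the claim, and the other half pays for their number, at most \<open>N\<close>, and for the
  additional factor 1 / N. Splitting the rows there presupposes that every earlier row is central.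
  The mesh ratio at that point is of order (ln N)^2 / N, so this holds above a threshold for
  \<open>N\<close> that depends on the data only. Below the threshold nothing is small, but nothing
  has to be: the error is bounded, and the power of \<open>N\<close> in the claim is bounded away
  from zero over finitely many \<open>N\<close>.\<close>

lemma mean_value_within:
  fixes f :: "real \<Rightarrow> real"
  assumes der: "\<And>x. x \<in> {a..b} \<Longrightarrow> (f has_real_derivative f' x) (at x within {a..b})"
    and "a \<le> s" "s < t" "t \<le> b"
  obtains r where "s < r" "r < t" "f t - f s = f' r * (t - s)"
proof -
  have sub: "{s..t} \<subseteq> {a..b}" using assms by auto
  have "\<exists>r\<in>{s<..<t}. f t - f s = (\<lambda>h. f' r * h) (t - s)"
  proof (rule mvt_simple[OF \<open>s < t\<close>])
    fix r assume "s \<le> r" "r \<le> t"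
    then have "(f has_real_derivative f' r) (at r within {s..t})"
      using der[of r] sub by (auto intro: DERIV_subset)
    then show "(f has_derivative (*) (f' r)) (at r within {s..t})"
      by (simp add: has_field_derivative_def)
  qed
  then show ?thesis using that by auto
qed

lemma nondecreasing_within:
  fixes f :: "real \<Rightarrow> real"
  assumes "\<And>x. x \<in> {a..b} \<Longrightarrow> (f has_real_derivative f' x) (at x within {a..b})"
    and "\<And>x. x \<in> {a..b} \<Longrightarrow> 0 \<le> f' x" and "a \<le> s" "s \<le> t" "t \<le> b"
  shows "f s \<le> f t"
proof (cases "s = t")
  case False
  then have "s < t" using assms by simp
  then obtain r where r: "s < r" "r < t" "f t - f s = f' r * (t - s)"
    using mean_value_within[of a b f f' s t] assms by metis
  have "0 \<le> f' r" using r assms by auto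
  then show ?thesis using r \<open>s < t\<close> by (smt (verit) mult_nonneg_nonneg)
qed simp

section \<open>The solution in the layer variable and the decay of its derivatives\<close>

lemma profile_derivatives:
  assumes "0 < \<epsilon>" and "bvp_solution b U_lo U_hi \<epsilon> u"
  obtains p where
    "\<And>t. t \<in> {0..1/\<epsilon>} \<Longrightarrow> ((\<lambda>t. u (\<epsilon> * t)) has_real_derivative p t) (at t within {0..1/\<epsilon>})"
    "\<And>t. t \<in> {0..1/\<epsilon>} \<Longrightarrow>
       (p has_real_derivative - (t * b (u (\<epsilon> * t)) * p t)) (at t within {0..1/\<epsilon>})"
proof -
  obtain u' u'' where u: "\<And>x. x \<in> {0..1} \<Longrightarrow> (u has_real_derivative u' x) (at x within {0..1})"
    "\<And>x. x \<in> {0..1} \<Longrightarrow> (u' has_real_derivative u'' x) (at x within {0..1})"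
    "\<And>x. x \<in> {0..1} \<Longrightarrow> \<epsilon>\<^sup>2 * u'' x + x * b (u x) * u' x = 0"
    using assms(2) unfolding bvp_solution_def by blast
  have mem: "\<epsilon> * t \<in> {0..1}" if "t \<in> {0..1/\<epsilon>}" for t
    using that assms(1) by (auto simp: field_simps)
  have img: "(\<lambda>t. \<epsilon> * t) ` {0..1/\<epsilon>} \<subseteq> {0..1}" using mem by blast
  have lin: "((\<lambda>t. \<epsilon> * t) has_real_derivative \<epsilon>) (at t within {0..1/\<epsilon>})" for t
    by (auto intro!: derivative_eq_intros)
  show ?thesis
  proof (rule that[of "\<lambda>t. \<epsilon> * u' (\<epsilon> * t)"])
    fix t assume t: "t \<in> {0..1/\<epsilon>}"
    have "(u \<circ> (\<lambda>t. \<epsilon> * t) has_real_derivative u' (\<epsilon> * t) * \<epsilon>) (at t within {0..1/\<epsilon>})"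
      by (rule DERIV_image_chain[OF DERIV_subset[OF u(1)[OF mem[OF t]] img] lin])
    then show "((\<lambda>t. u (\<epsilon> * t)) has_real_derivative \<epsilon> * u' (\<epsilon> * t)) (at t within {0..1/\<epsilon>})"
      by (simp add: o_def mult.commute)
    have "(u' \<circ> (\<lambda>t. \<epsilon> * t) has_real_derivative u'' (\<epsilon> * t) * \<epsilon>) (at t within {0..1/\<epsilon>})"
      by (rule DERIV_image_chain[OF DERIV_subset[OF u(2)[OF mem[OF t]] img] lin])
    from DERIV_cmult[OF this, of \<epsilon>]
    have "((\<lambda>t. \<epsilon> * u' (\<epsilon> * t)) has_real_derivative \<epsilon>\<^sup>2 * u'' (\<epsilon> * t)) (at t within {0..1/\<epsilon>})"
      by (simp add: o_def power2_eq_square mult_ac)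
    moreover have "\<epsilon>\<^sup>2 * u'' (\<epsilon> * t) = - (t * b (u (\<epsilon> * t)) * (\<epsilon> * u' (\<epsilon> * t)))"
      using u(3)[OF mem[OF t]] by (simp add: mult_ac)
    ultimately show "((\<lambda>t. \<epsilon> * u' (\<epsilon> * t)) has_real_derivative
        - (t * b (u (\<epsilon> * t)) * (\<epsilon> * u' (\<epsilon> * t)))) (at t within {0..1/\<epsilon>})" by simp
  qed
qed

text \<open>The equation is linear in \<open>p\<close> once \<open>\<beta>\<close> is regarded as
  given: with a primitive \<open>B\<close> of \<open>t * \<beta> t\<close>, the product
  \<open>p t * exp (B t)\<close> is a constant \<open>C\<close>. Its sign comes from the total
  increase of \<open>v\<close>, its size from the increase over the unit interval, and
  \<open>B\<close> lies between the two parabolas given by the bounds on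
  \<open>\<beta>\<close>.\<close>

lemma profile_slope_bounds:
  fixes v p \<beta> :: "real \<Rightarrow> real"
  assumes R: "1 \<le> R"
    and v: "\<And>t. t \<in> {0..R} \<Longrightarrow> (v has_real_derivative p t) (at t within {0..R})"
    and p: "\<And>t. t \<in> {0..R} \<Longrightarrow> (p has_real_derivative - (t * \<beta> t * p t)) (at t within {0..R})"
    and cont: "continuous_on {0..R} \<beta>"
    and b_lo: "0 < b_lo"
    and \<beta>: "\<And>t. t \<in> {0..R} \<Longrightarrow> b_lo \<le> \<beta> t \<and> \<beta> t \<le> b_hi"
    and rng: "v 0 < v R" "\<And>t. t \<in> {0..R} \<Longrightarrow> v t \<le> v R"
    and t: "t \<in> {0..R}"
  shows "0 \<le> p t" and "p t \<le> (v R - v 0) * exp (b_hi / 2) * exp (- (b_lo / 2 * t\<^sup>2))"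
proof -
  have "continuous_on {0..R} (\<lambda>t. t * \<beta> t)" by (intro continuous_intros cont)
  then obtain B0 where B0: "\<And>t. t \<in> {0..R} \<Longrightarrow>
      (B0 has_vector_derivative (t * \<beta> t)) (at t within {0..R})"
    using antiderivative_continuous by blast
  define B where "B t = B0 t - B0 0" for t
  have B: "(B has_real_derivative t * \<beta> t) (at t within {0..R})" if "t \<in> {0..R}" for t
    using B0[OF that] unfolding B_def has_real_derivative_iff_has_vector_derivative
    by (auto intro!: derivative_eq_intros)
  have "\<exists>C. \<forall>t\<in>{0..R}. p t * exp (B t) = C"
  proof (rule has_field_derivative_zero_constant)
    fix t assume "t \<in> {0..R}"
    from p[OF this] B[OF this]
    show "((\<lambda>t. p t * exp (B t)) has_real_derivative 0) (at t within {0..R})"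
      by (auto intro!: derivative_eq_intros simp: algebra_simps)
  qed simp
  then obtain C where C: "\<And>t. t \<in> {0..R} \<Longrightarrow> p t * exp (B t) = C" by blast
  have pB: "p t = C * exp (- B t)" if "t \<in> {0..R}" for t
    using C[OF that] by (simp add: exp_minus field_simps)
  have lo: "b_lo / 2 * t\<^sup>2 \<le> B t" if "t \<in> {0..R}" for t
  proof -
    have "B 0 - b_lo / 2 * 0\<^sup>2 \<le> B t - b_lo / 2 * t\<^sup>2"
    proof (rule nondecreasing_within[where a=0 and b=R and f="\<lambda>t. B t - b_lo / 2 * t\<^sup>2"])
      fix t assume t: "t \<in> {0..R}"
      show "((\<lambda>t. B t - b_lo / 2 * t\<^sup>2) has_real_derivative t * (\<beta> t - b_lo)) (at t within {0..R})"
        using B[OF t] by (auto intro!: derivative_eq_intros simp: algebra_simps)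
      show "0 \<le> t * (\<beta> t - b_lo)" using t \<beta>[OF t] by auto
    qed (use that in auto)
    then show ?thesis by (simp add: B_def)
  qed
  have hi: "B t \<le> b_hi / 2 * t\<^sup>2" if "t \<in> {0..R}" for t
  proof -
    have "b_hi / 2 * 0\<^sup>2 - B 0 \<le> b_hi / 2 * t\<^sup>2 - B t"
    proof (rule nondecreasing_within[where a=0 and b=R and f="\<lambda>t. b_hi / 2 * t\<^sup>2 - B t"])
      fix t assume t: "t \<in> {0..R}"
      show "((\<lambda>t. b_hi / 2 * t\<^sup>2 - B t) has_real_derivative t * (b_hi - \<beta> t)) (at t within {0..R})"
        using B[OF t] by (auto intro!: derivative_eq_intros simp: algebra_simps)
      show "0 \<le> t * (b_hi - \<beta> t)" using t \<beta>[OF t] by auto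
    qed (use that in auto)
    then show ?thesis by (simp add: B_def)
  qed
  obtain r where r: "0 < r" "r < R" "v R - v 0 = p r * (R - 0)"
    using mean_value_within[of 0 R v p 0 R] v R by auto
  then have "0 < p r * R" using rng(1) by simp
  then have "0 < p r" using R by (simp add: zero_less_mult_iff)
  then have Cpos: "0 < C" using pB[of r] r by (simp add: zero_less_mult_iff)
  \<comment> \<open>The interval from 0 to 1 is used instead of the whole range so that the bound on
    \<open>C\<close> does not depend on \<open>R\<close>, that is, on \<epsilon>; on it
    \<open>B\<close> is at most \<open>b_hi / 2\<close>, the source of
    \<open>exp (b_hi / 2)\<close>.\<close>
  obtain s where s: "0 < s" "s < 1" "v 1 - v 0 = p s * (1 - 0)"
    using mean_value_within[of 0 R v p 0 1] v R by auto
  have "C * exp (- (b_hi / 2)) \<le> p s"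
  proof -
    have "0 \<le> b_hi" using \<beta>[of 0] R b_lo by auto
    moreover have "s\<^sup>2 \<le> 1" using s by (simp add: power_le_one)
    ultimately have "b_hi / 2 * s\<^sup>2 \<le> b_hi / 2 * 1" by (intro mult_left_mono) auto
    then have "B s \<le> b_hi / 2" using hi[of s] s R by simp
    then show ?thesis using pB[of s] s R Cpos by simp
  qed
  also have "p s \<le> v R - v 0" using s rng(2)[of 1] R by simp
  finally have C_le: "C \<le> (v R - v 0) * exp (b_hi / 2)" by (simp add: exp_minus field_simps)
  show "0 \<le> p t" using pB[OF t] Cpos by simp
  have "p t \<le> C * exp (- (b_lo / 2 * t\<^sup>2))" using pB[OF t] lo[OF t] Cpos by simp
  also have "\<dots> \<le> (v R - v 0) * exp (b_hi / 2) * exp (- (b_lo / 2 * t\<^sup>2))"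
    using C_le by (rule mult_right_mono) simp
  finally show "p t \<le> (v R - v 0) * exp (b_hi / 2) * exp (- (b_lo / 2 * t\<^sup>2))" .
qed

lemma flux_x_has_derivative:
  assumes "continuous_on {U_lo..U_hi} b" and "U_lo \<le> U_hi" and "v \<in> {U_lo..U_hi}"
  shows "(flux_x b U_hi y has_real_derivative b v) (at v within {U_lo..U_hi})"
proof -
  have "((\<lambda>u. LBINT t=ereal U_hi..ereal u. b t) has_vector_derivative b v)
      (at v within {U_lo..U_hi})"
    by (rule interval_integral_FTC2) (use assms in auto)
  then show ?thesis
    by (simp add: flux_x_def[abs_def] has_real_derivative_iff_has_vector_derivative)
qed

lemma flux_x_endpoint: "flux_x b U_hi y U_hi = 0"
  by (simp add: flux_x_def interval_integral_endpoints_same)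

lemma C_k_on_has_derivative:
  assumes "C_k_on (Suc k) g S"
  obtains g' where "\<And>x. x \<in> S \<Longrightarrow> (g has_real_derivative g' x) (at x within S)"
    and "C_k_on k g' S"
  using assms by auto

lemma C_k_on_imp_continuous_on: "C_k_on k g S \<Longrightarrow> continuous_on S g"
  by (cases k) (auto intro: DERIV_continuous_on)

text \<open>\<open>v\<close> is the solution in the layer variable \<open>t = x / \<epsilon>\<close>, \<open>F\<close> a primitive of \<open>b\<close> and
  \<open>t * F (v t)\<close> the flux, whose derivatives are \<open>F (v t) - p1 t\<close>, \<open>g2 t\<close>, \<open>g3 t\<close>.\<close>

definition layer_profile ::
  "(real \<Rightarrow> real) \<Rightarrow> real \<Rightarrow> real \<Rightarrow> real \<Rightarrow> real \<Rightarrow> real \<Rightarrow> (real \<Rightarrow> real) \<Rightarrow> bool" where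
  "layer_profile F U_hi A m K R v \<longleftrightarrow>
     (\<exists>p p1 p2 p3 g2 g3. \<forall>t\<in>{0..R}.
        (v has_real_derivative p t) (at t within {0..R}) \<and>
        (p has_real_derivative p1 t) (at t within {0..R}) \<and>
        (p1 has_real_derivative p2 t) (at t within {0..R}) \<and>
        (p2 has_real_derivative p3 t) (at t within {0..R}) \<and>
        ((\<lambda>t. t * F (v t)) has_real_derivative F (v t) - p1 t) (at t within {0..R}) \<and>
        ((\<lambda>t. F (v t) - p1 t) has_real_derivative g2 t) (at t within {0..R}) \<and>
        (g2 has_real_derivative g3 t) (at t within {0..R}) \<and>
        \<bar>p2 t\<bar> \<le> K * exp (- (A * t)) \<and> \<bar>p3 t\<bar> \<le> K * exp (- (A * t)) \<and>
        \<bar>g2 t\<bar> \<le> K * exp (- (A * t)) \<and> \<bar>g3 t\<bar> \<le> K * exp (- (A * t)) \<and>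
        0 \<le> p t \<and> p t \<le> K * exp (- (m * t\<^sup>2)) \<and>
        U_hi - v t \<le> K * exp (- (m * t\<^sup>2)))"

lemma abs_mult_le_mult:
  fixes x y a c :: "real"
  assumes "\<bar>x\<bar> \<le> a" "\<bar>y\<bar> \<le> c"
  shows "\<bar>x * y\<bar> \<le> a * c"
  using assms by (simp add: abs_mult mult_mono')

text \<open>Each monomial in these derivatives contains a factor \<open>p\<close>, and all other
  factors are at most \<open>a\<close>. The power 6 comes from \<open>t * c * p2\<close>, and the
  number 13 counts the monomials of the last expression: 11 from \<open>p3\<close> and one for each
  of the two other terms.\<close>

lemma layer_derivative_bounds:
  fixes a p t c c' c'' :: real
  assumes "1 \<le> a" "\<bar>t\<bar> \<le> a" "\<bar>p\<bar> \<le> a" "\<bar>c\<bar> \<le> a" "\<bar>c'\<bar> \<le> a" "\<bar>c''\<bar> \<le> a"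
    and p1: "p1 = - (t * c * p)" and p2: "p2 = - (c * p + t * c' * p\<^sup>2 + t * c * p1)"
    and p3: "p3 = - (2 * c' * p\<^sup>2 + 2 * c * p1 + t * c'' * p ^ 3 + 3 * t * c' * p * p1 + t * c * p2)"
  shows "\<bar>p2\<bar> \<le> 13 * a ^ 6 * \<bar>p\<bar>" "\<bar>p3\<bar> \<le> 13 * a ^ 6 * \<bar>p\<bar>"
    "\<bar>c * p - p2\<bar> \<le> 13 * a ^ 6 * \<bar>p\<bar>" "\<bar>c' * p\<^sup>2 + c * p1 - p3\<bar> \<le> 13 * a ^ 6 * \<bar>p\<bar>"
proof -
  define P where "P = \<bar>p\<bar>"
  have P: "\<bar>p\<bar> \<le> P" "0 \<le> P" by (simp_all add: P_def)
  have pow: "a ^ i * P \<le> a ^ 6 * P" if "i \<le> 6" for i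
    using assms(1) P that by (intro mult_right_mono power_increasing)
  note M = abs_mult_le_mult
  have b1: "\<bar>p1\<bar> \<le> a ^ 2 * P"
    using M[OF M[OF assms(2,4)] P(1)] by (simp add: p1 power2_eq_square)
  have x1: "\<bar>c * p\<bar> \<le> a ^ 1 * P" using M[OF assms(4) P(1)] by simp
  have x2: "\<bar>t * c' * p\<^sup>2\<bar> \<le> a ^ 3 * P"
    using M[OF M[OF M[OF assms(2,5)] assms(3)] P(1)]
    by (simp add: power2_eq_square power3_eq_cube mult_ac)
  have x3: "\<bar>t * c * p1\<bar> \<le> a ^ 4 * P"
    using M[OF M[OF assms(2,4)] b1] by (simp add: power2_eq_square power4_eq_xxxx mult_ac)
  have b2: "\<bar>p2\<bar> \<le> 3 * a ^ 4 * P"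
  proof -
    have "a ^ 1 * P \<le> a ^ 4 * P" "a ^ 3 * P \<le> a ^ 4 * P"
      using assms(1) P by (intro mult_right_mono power_increasing; simp)+
    then show ?thesis using x1 x2 x3 unfolding p2 by linarith
  qed
  have y1: "\<bar>c' * p\<^sup>2\<bar> \<le> a ^ 2 * P"
    using M[OF M[OF assms(5,3)] P(1)] by (simp add: power2_eq_square mult_ac)
  have y2: "\<bar>c * p1\<bar> \<le> a ^ 3 * P"
    using M[OF assms(4) b1] by (simp add: power2_eq_square power3_eq_cube mult_ac)
  have y3: "\<bar>t * c'' * p ^ 3\<bar> \<le> a ^ 4 * P"
    using M[OF M[OF M[OF M[OF assms(2,6)] assms(3)] assms(3)] P(1)]
    by (simp add: power3_eq_cube power4_eq_xxxx mult_ac)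
  have y4: "\<bar>t * c' * p * p1\<bar> \<le> a ^ 5 * P"
    using M[OF M[OF M[OF assms(2,5)] assms(3)] b1]
    by (simp add: eval_nat_numeral mult_ac)
  have y5: "\<bar>t * c * p2\<bar> \<le> 3 * a ^ 6 * P"
    using M[OF M[OF assms(2,4)] b2] by (simp add: eval_nat_numeral mult_ac)
  have "\<bar>p3\<bar> \<le> 2 * (a ^ 2 * P) + 2 * (a ^ 3 * P) + a ^ 4 * P + 3 * (a ^ 5 * P) + 3 * a ^ 6 * P"
    using y1 y2 y3 y4 y5 unfolding p3 by (simp add: mult.assoc)
  then have b3: "\<bar>p3\<bar> \<le> 11 * (a ^ 6 * P)"
    using pow[of 2] pow[of 3] pow[of 4] pow[of 5] by simp
  have nn: "0 \<le> a ^ 6 * P" using assms(1) P by simp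
  show "\<bar>p2\<bar> \<le> 13 * a ^ 6 * \<bar>p\<bar>"
    using b2 pow[of 4] nn by (simp add: P_def[symmetric])
  show "\<bar>p3\<bar> \<le> 13 * a ^ 6 * \<bar>p\<bar>" using b3 nn by (simp add: P_def[symmetric])
  show "\<bar>c * p - p2\<bar> \<le> 13 * a ^ 6 * \<bar>p\<bar>"
    using x1 b2 pow[of 1] pow[of 4] nn by (simp add: P_def[symmetric])
  show "\<bar>c' * p\<^sup>2 + c * p1 - p3\<bar> \<le> 13 * a ^ 6 * \<bar>p\<bar>"
    using y1 y2 b3 pow[of 2] pow[of 3] by (simp add: P_def[symmetric])
qed

text \<open>A Gaussian beats every exponential, so the rate \<open>A\<close> is arbitrary; only
  \<open>K\<close> depends on it. Half of the exponent \<open>b_lo / 2\<close> of the slope is given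
  up (\<open>m = b_lo / 4\<close>) to absorb lower order factors.\<close>

lemma layer_profile_exists:
  fixes b :: "real \<Rightarrow> real" and U_lo U_hi b_lo b_hi A :: real
  assumes "U_lo < U_hi" and C3: "C_k_on 3 b {U_lo..U_hi}" and "0 < b_lo"
    and bnd: "\<And>v. v \<in> {U_lo..U_hi} \<Longrightarrow> b_lo \<le> b v \<and> b v \<le> b_hi"
  obtains K where "0 < K" and
    "\<And>\<epsilon> u. \<lbrakk>0 < \<epsilon>; \<epsilon> \<le> 1; bvp_solution b U_lo U_hi \<epsilon> u\<rbrakk> \<Longrightarrow>
       layer_profile (flux_x b U_hi 0) U_hi A (b_lo / 4) K (1 / \<epsilon>) (\<lambda>t. u (\<epsilon> * t))"
proof -
  let ?U = "{U_lo..U_hi}"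
  define F where "F = flux_x b U_hi 0"
  obtain b1 where b1: "\<And>x. x \<in> ?U \<Longrightarrow> (b has_real_derivative b1 x) (at x within ?U)"
    "C_k_on 2 b1 ?U"
    using C_k_on_has_derivative[of 2 b ?U] C3 by (metis eval_nat_numeral(3))
  obtain b2 where b2: "\<And>x. x \<in> ?U \<Longrightarrow> (b1 has_real_derivative b2 x) (at x within ?U)"
    "C_k_on 1 b2 ?U"
    using C_k_on_has_derivative[of 1 b1 ?U] b1(2) by (metis Suc_1)
  have contb: "continuous_on ?U b" using C3 by (rule C_k_on_imp_continuous_on)
  obtain B1 where B1: "\<And>x. x \<in> ?U \<Longrightarrow> \<bar>b1 x\<bar> \<le> B1"
    using compact_imp_bounded[OF compact_continuous_image[OF C_k_on_imp_continuous_on[OF b1(2)]]]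
    unfolding bounded_iff by fastforce
  obtain B2 where B2: "\<And>x. x \<in> ?U \<Longrightarrow> \<bar>b2 x\<bar> \<le> B2"
    using compact_imp_bounded[OF compact_continuous_image[OF C_k_on_imp_continuous_on[OF b2(2)]]]
    unfolding bounded_iff by fastforce
  define C0 where "C0 = (U_hi - U_lo) * exp (b_hi / 2)"
  define D where "D = 1 + b_hi + B1 + B2 + C0"
  have C0: "0 < C0" using assms(1) by (simp add: C0_def)
  have "U_lo \<in> ?U" using assms(1) by simp
  then have pos: "0 \<le> B1" "0 \<le> B2" "0 < b_hi"
    using B1[of U_lo] B2[of U_lo] bnd[of U_lo] assms(3) by auto
  define m where "m = b_lo / 4"
  have m: "0 < m" using assms(3) by (simp add: m_def)
  \<comment> \<open>Both exponents are maxima found by completing the square: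
    \<open>1 / (4 * m)\<close> is the maximum of \<open>t - m * t\<^sup>2\<close>, and
    \<open>(A + 6)\<^sup>2 / (8 * m)\<close> that of
    \<open>(A + 6) * t - 2 * m * t\<^sup>2\<close>.\<close>
  define K1 where "K1 = C0 * exp (1 / (4 * m))"
  define K2 where "K2 = 13 * D ^ 6 * C0 * exp ((A + 6)\<^sup>2 / (8 * m))"
  define K where "K = K1 + K2"
  have D: "1 \<le> D" using pos C0 by (simp add: D_def)
  have K1: "0 < K1" and K2: "0 < K2" using C0 D by (simp_all add: K1_def K2_def)
  have "layer_profile F U_hi A m K (1 / \<epsilon>) (\<lambda>t. u (\<epsilon> * t))"
    if \<epsilon>: "0 < \<epsilon>" "\<epsilon> \<le> 1" and sol: "bvp_solution b U_lo U_hi \<epsilon> u" for \<epsilon> u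
  proof -
    define R where "R = 1 / \<epsilon>"
    define v where "v = (\<lambda>t. u (\<epsilon> * t))"
    obtain p where v': "\<And>t. t \<in> {0..R} \<Longrightarrow> (v has_real_derivative p t) (at t within {0..R})"
      and p': "\<And>t. t \<in> {0..R} \<Longrightarrow> (p has_real_derivative - (t * b (v t) * p t)) (at t within {0..R})"
      using profile_derivatives[OF \<epsilon>(1) sol] unfolding R_def v_def by metis
    have R: "1 \<le> R" using \<epsilon> by (simp add: R_def)
    have vU: "v t \<in> ?U" if "t \<in> {0..R}" for t
    proof -
      have "\<epsilon> * t \<in> {0..1}" using that \<epsilon> by (auto simp: R_def field_simps)
      then show ?thesis using sol unfolding bvp_solution_def v_def by blast
    qed
    have v0: "v 0 = U_lo" and vR: "v R = U_hi"
      using sol \<epsilon> unfolding bvp_solution_def v_def R_def by auto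
    have img: "v ` {0..R} \<subseteq> ?U" using vU by blast
    have comp: "((\<lambda>t. f (v t)) has_real_derivative f' (v t) * p t) (at t within {0..R})"
      if "\<And>x. x \<in> ?U \<Longrightarrow> (f has_real_derivative f' x) (at x within ?U)" "t \<in> {0..R}" for f f' t
      using DERIV_image_chain[OF DERIV_subset[OF that(1)[OF vU[OF that(2)]] img] v'[OF that(2)]]
      by (simp add: o_def)
    have db: "((\<lambda>t. b (v t)) has_real_derivative b1 (v t) * p t) (at t within {0..R})"
      if "t \<in> {0..R}" for t
      by (rule comp[OF b1(1) that])
    have db1: "((\<lambda>t. b1 (v t)) has_real_derivative b2 (v t) * p t) (at t within {0..R})"
      if "t \<in> {0..R}" for t
      by (rule comp[OF b2(1) that])
    have F': "(F has_real_derivative b x) (at x within ?U)" if "x \<in> ?U" for x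
      unfolding F_def using flux_x_has_derivative[OF contb _ that] assms(1) by simp
    have dF: "((\<lambda>t. F (v t)) has_real_derivative b (v t) * p t) (at t within {0..R})"
      if "t \<in> {0..R}" for t
      by (rule comp[OF F' that])
    have "continuous_on {0..R} v" using v' by (rule DERIV_continuous_on)
    then have "continuous_on {0..R} (\<lambda>t. b (v t))"
      by (rule continuous_on_compose2[OF contb _ img])
    note slope = profile_slope_bounds[OF R v' p' this assms(3)]
    have p0: "0 \<le> p t" and pC: "p t \<le> C0 * exp (- (b_lo / 2 * t\<^sup>2))" if "t \<in> {0..R}" for t
      using slope[of b_hi t] that vU bnd v0 vR assms(1) by (auto simp: C0_def)
    define p1 where "p1 t = - (t * b (v t) * p t)" for t
    define p2 where "p2 t = - (b (v t) * p t + t * b1 (v t) * (p t)\<^sup>2 + t * b (v t) * p1 t)" for t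
    define p3 where "p3 t = - (2 * b1 (v t) * (p t)\<^sup>2 + 2 * b (v t) * p1 t + t * b2 (v t) * p t ^ 3
        + 3 * t * b1 (v t) * p t * p1 t + t * b (v t) * p2 t)" for t
    have d1: "(p has_real_derivative p1 t) (at t within {0..R})" if "t \<in> {0..R}" for t
      using p'[OF that] by (simp add: p1_def)
    have d2: "(p1 has_real_derivative p2 t) (at t within {0..R})" if "t \<in> {0..R}" for t
      unfolding p1_def[abs_def]
      by (rule derivative_eq_intros d1[OF that] db[OF that] refl)+
         (simp add: p2_def p1_def algebra_simps power2_eq_square)
    have d3: "(p2 has_real_derivative p3 t) (at t within {0..R})" if "t \<in> {0..R}" for t
      unfolding p2_def[abs_def]
      by (rule derivative_eq_intros d1[OF that] d2[OF that] db[OF that] db1[OF that] refl)+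
         (simp add: p3_def algebra_simps power2_eq_square power3_eq_cube)
    have e1: "((\<lambda>t. t * F (v t)) has_real_derivative F (v t) - p1 t) (at t within {0..R})"
      if "t \<in> {0..R}" for t
      by (rule derivative_eq_intros dF[OF that] refl)+ (simp add: p1_def)
    have e2: "((\<lambda>t. F (v t) - p1 t) has_real_derivative b (v t) * p t - p2 t) (at t within {0..R})"
      if "t \<in> {0..R}" for t
      by (rule derivative_eq_intros dF[OF that] d2[OF that] refl)+
    have e3: "((\<lambda>t. b (v t) * p t - p2 t) has_real_derivative
        b1 (v t) * (p t)\<^sup>2 + b (v t) * p1 t - p3 t) (at t within {0..R})"
      if "t \<in> {0..R}" for t
      by (rule derivative_eq_intros db[OF that] d1[OF that] d3[OF that] refl)+
         (simp add: power2_eq_square mult_ac)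
    \<comment> \<open>The bound \<open>a\<close> of \<open>layer_derivative_bounds\<close> is taken
      as \<open>D * exp t\<close>, which also dominates the unbounded factor \<open>t\<close>. Its
      sixth power costs \<open>exp (6 * t)\<close>, hence the 6 in \<open>K2\<close>.\<close>
    have le13: "x \<le> K * exp (- (A * t))" if "x \<le> 13 * (D * exp t) ^ 6 * \<bar>p t\<bar>" "t \<in> {0..R}" for x t
    proof -
      have "13 * (D * exp t) ^ 6 * \<bar>p t\<bar> = 13 * D ^ 6 * exp (6 * t) * p t"
        using p0[OF that(2)] by (simp add: power_mult_distrib exp_of_nat_mult[symmetric])
      also have "\<dots> \<le> 13 * D ^ 6 * exp (6 * t) * (C0 * exp (- (b_lo / 2 * t\<^sup>2)))"
        using pC[OF that(2)] D by (intro mult_left_mono) auto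
      also have "\<dots> = 13 * D ^ 6 * C0 * exp (6 * t - 2 * m * t\<^sup>2)"
        by (simp add: m_def exp_add[symmetric] algebra_simps)
      also have "\<dots> \<le> 13 * D ^ 6 * C0 * exp ((A + 6)\<^sup>2 / (8 * m) - A * t)"
      proof -
        have "(A + 6)\<^sup>2 / (8 * m) - A * t - (6 * t - 2 * m * t\<^sup>2) = 2 * m * (t - (A + 6) / (4 * m))\<^sup>2"
          using m by (simp add: field_simps power2_eq_square)
        moreover have "0 \<le> 2 * m * (t - (A + 6) / (4 * m))\<^sup>2" using m by simp
        ultimately have "6 * t - 2 * m * t\<^sup>2 \<le> (A + 6)\<^sup>2 / (8 * m) - A * t" by linarith
        then show ?thesis using C0 D by (intro mult_left_mono) auto
      qed
      also have "\<dots> = K2 * exp (- (A * t))" by (simp add: K2_def exp_diff exp_minus field_simps)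
      also have "\<dots> \<le> K * exp (- (A * t))" using K1 by (intro mult_right_mono) (auto simp: K_def)
      finally show ?thesis using that by simp
    qed
    have bd: "\<bar>p2 t\<bar> \<le> K * exp (- (A * t))" "\<bar>p3 t\<bar> \<le> K * exp (- (A * t))"
       "\<bar>b (v t) * p t - p2 t\<bar> \<le> K * exp (- (A * t))"
       "\<bar>b1 (v t) * (p t)\<^sup>2 + b (v t) * p1 t - p3 t\<bar> \<le> K * exp (- (A * t))"
      if t: "t \<in> {0..R}" for t
    proof -
      have q: "1 \<le> exp t" "t \<le> exp t" using t exp_ge_add_one_self[of t] by (auto simp del: exp_ge_add_one_self)
      have Dq: "D \<le> D * exp t" using mult_left_mono[OF q(1), of D] D by simp
      have "exp t \<le> D * exp t" using D by simp
      then have "t \<le> D * exp t" using q(2) by linarith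
      moreover have "p t \<le> C0 * 1"
        using pC[OF t] assms(3) C0 by (elim order_trans) (intro mult_left_mono, auto)
      moreover have "1 \<le> D" "b_hi \<le> D" "B1 \<le> D" "B2 \<le> D" "C0 \<le> D"
        using pos C0 by (simp_all add: D_def)
      moreover have "\<bar>b (v t)\<bar> \<le> b_hi" using bnd[OF vU[OF t]] assms(3) by auto
      ultimately have h: "1 \<le> D * exp t" "\<bar>t\<bar> \<le> D * exp t" "\<bar>p t\<bar> \<le> D * exp t"
        "\<bar>b (v t)\<bar> \<le> D * exp t" "\<bar>b1 (v t)\<bar> \<le> D * exp t" "\<bar>b2 (v t)\<bar> \<le> D * exp t"
        using t Dq p0[OF t] B1[OF vU[OF t]] B2[OF vU[OF t]]
        by - (simp only: atLeastAtMost_iff; linarith)+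
      note L = layer_derivative_bounds[OF h p1_def p2_def p3_def]
      show "\<bar>p2 t\<bar> \<le> K * exp (- (A * t))" "\<bar>p3 t\<bar> \<le> K * exp (- (A * t))"
       "\<bar>b (v t) * p t - p2 t\<bar> \<le> K * exp (- (A * t))"
       "\<bar>b1 (v t) * (p t)\<^sup>2 + b (v t) * p1 t - p3 t\<bar> \<le> K * exp (- (A * t))"
        by (rule le13[OF L(1) t] le13[OF L(2) t] le13[OF L(3) t] le13[OF L(4) t])+
    qed
    \<comment> \<open>The additional factor \<open>exp (- t)\<close> serves the integration in
      \<open>gauss\<close>: the majorant then decreases at a rate of at least its own size, also
      near \<open>t = 0\<close>, where the Gaussian alone is flat.\<close>
    have pg: "p t \<le> K1 * exp (- (m * t\<^sup>2) - t)" if "t \<in> {0..R}" for t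
    proof -
      have "1 / (4 * m) - m * t\<^sup>2 - t - - (b_lo / 2 * t\<^sup>2) = m * (t - 1 / (2 * m))\<^sup>2"
        using m by (simp add: m_def field_simps power2_eq_square)
      moreover have "0 \<le> m * (t - 1 / (2 * m))\<^sup>2" using m by simp
      ultimately have "- (b_lo / 2 * t\<^sup>2) \<le> 1 / (4 * m) + (- (m * t\<^sup>2) - t)" by linarith
      then have "C0 * exp (- (b_lo / 2 * t\<^sup>2)) \<le> C0 * exp (1 / (4 * m) + (- (m * t\<^sup>2) - t))"
        using C0 by simp
      also have "\<dots> = K1 * exp (- (m * t\<^sup>2) - t)" by (simp add: K1_def exp_add[symmetric] mult.assoc)
      finally show ?thesis using pC[OF that] by simp
    qed
    have drop: "K1 * exp (- (m * t\<^sup>2) - t) \<le> K * exp (- (m * t\<^sup>2))" if "t \<in> {0..R}" for t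
      using that K1 K2 by (intro mult_mono) (auto simp: K_def)
    have gauss: "U_hi - v t \<le> K1 * exp (- (m * t\<^sup>2) - t)" if t: "t \<in> {0..R}" for t
    proof -
      let ?f = "\<lambda>t. U_hi - v t - K1 * exp (- (m * t\<^sup>2) - t)"
      have "?f t \<le> ?f R"
      proof (rule nondecreasing_within[where a=0 and b=R and f="?f"])
        fix s assume s: "s \<in> {0..R}"
        show "(?f has_real_derivative - p s + K1 * exp (- (m * s\<^sup>2) - s) * (2 * m * s + 1))
            (at s within {0..R})"
          by (rule derivative_eq_intros v'[OF s] refl)+ (simp add: algebra_simps)
        have "K1 * exp (- (m * s\<^sup>2) - s) * 1 \<le> K1 * exp (- (m * s\<^sup>2) - s) * (2 * m * s + 1)"
          using m s K1 by (intro mult_left_mono) auto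
        then show "0 \<le> - p s + K1 * exp (- (m * s\<^sup>2) - s) * (2 * m * s + 1)"
          using pg[OF s] by simp
      qed (use t in auto)
      also have "?f R \<le> 0" using vR K1 by simp
      finally show ?thesis by simp
    qed
    show ?thesis
      unfolding layer_profile_def R_def[symmetric] v_def[symmetric]
      apply (rule exI[of _ p], rule exI[of _ p1], rule exI[of _ p2], rule exI[of _ p3],
          rule exI[of _ "\<lambda>t. b (v t) * p t - p2 t"],
          rule exI[of _ "\<lambda>t. b1 (v t) * (p t)\<^sup>2 + b (v t) * p1 t - p3 t"], intro ballI conjI)
      using v' d1 d2 d3 e1 e2 e3 bd p0 order_trans[OF pg drop] order_trans[OF gauss drop]
      by auto
  qed
  then show ?thesis using that[of K] K1 K2 unfolding K_def F_def m_def by auto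
qed

section \<open>Taylor remainders and consistency of the central scheme\<close>

lemma taylor_order2:
  fixes f0 f1 f2 :: "real \<Rightarrow> real"
  assumes "\<And>x. x \<in> S \<Longrightarrow> (f0 has_real_derivative f1 x) (at x within S)"
    and "\<And>x. x \<in> S \<Longrightarrow> (f1 has_real_derivative f2 x) (at x within S)"
    and "\<And>x. x \<in> S \<Longrightarrow> \<bar>f2 x\<bar> \<le> M" and "convex S" "w \<in> S" "z \<in> S"
  shows "\<bar>f0 z - f0 w - f1 w * (z - w)\<bar> \<le> M * \<bar>z - w\<bar>\<^sup>2"
proof -
  \<comment> \<open>\<open>field_Taylor\<close> divides the remainder of a polynomial of degree k by
    k! and not by (k + 1)!. The same holds in the two lemmas below; the loss only affects
    constants.\<close>
  have "norm (([f0, f1, f2] ! 0) z - (\<Sum>i\<le>1. ([f0, f1, f2] ! i) w * (z-w) ^ i / fact i))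
      \<le> M * norm (z - w) ^ Suc 1 / fact 1"
    by (rule field_Taylor[OF \<open>convex S\<close>]) (use assms in \<open>auto simp: le_Suc_eq\<close>)
  then show ?thesis by (simp add: algebra_simps power2_eq_square)
qed

lemma taylor_order3:
  fixes f0 f1 f2 f3 :: "real \<Rightarrow> real"
  assumes "\<And>x. x \<in> S \<Longrightarrow> (f0 has_real_derivative f1 x) (at x within S)"
    and "\<And>x. x \<in> S \<Longrightarrow> (f1 has_real_derivative f2 x) (at x within S)"
    and "\<And>x. x \<in> S \<Longrightarrow> (f2 has_real_derivative f3 x) (at x within S)"
    and "\<And>x. x \<in> S \<Longrightarrow> \<bar>f3 x\<bar> \<le> M" and "convex S" "w \<in> S" "z \<in> S"
  shows "\<bar>f0 z - f0 w - f1 w * (z - w) - f2 w * (z - w)\<^sup>2 / 2\<bar> \<le> M * \<bar>z - w\<bar> ^ 3 / 2"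
proof -
  have "norm (([f0, f1, f2, f3] ! 0) z - (\<Sum>i\<le>2. ([f0, f1, f2, f3] ! i) w * (z-w) ^ i / fact i))
      \<le> M * norm (z - w) ^ Suc 2 / fact 2"
    by (rule field_Taylor[OF \<open>convex S\<close>])
       (use assms in \<open>auto simp: le_Suc_eq numeral_2_eq_2 numeral_3_eq_3\<close>)
  then show ?thesis by (simp add: numeral_2_eq_2 numeral_3_eq_3 algebra_simps)
qed

lemma taylor_order4:
  fixes f0 f1 f2 f3 f4 :: "real \<Rightarrow> real"
  assumes "\<And>x. x \<in> S \<Longrightarrow> (f0 has_real_derivative f1 x) (at x within S)"
    and "\<And>x. x \<in> S \<Longrightarrow> (f1 has_real_derivative f2 x) (at x within S)"
    and "\<And>x. x \<in> S \<Longrightarrow> (f2 has_real_derivative f3 x) (at x within S)"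
    and "\<And>x. x \<in> S \<Longrightarrow> (f3 has_real_derivative f4 x) (at x within S)"
    and "\<And>x. x \<in> S \<Longrightarrow> \<bar>f4 x\<bar> \<le> M" and "convex S" "w \<in> S" "z \<in> S"
  shows "\<bar>f0 z - f0 w - f1 w * (z - w) - f2 w * (z - w)\<^sup>2 / 2 - f3 w * (z - w) ^ 3 / 6\<bar>
    \<le> M * \<bar>z - w\<bar> ^ 4 / 6"
proof -
  have "norm (([f0, f1, f2, f3, f4] ! 0) z -
        (\<Sum>i\<le>3. ([f0, f1, f2, f3, f4] ! i) w * (z-w) ^ i / fact i))
      \<le> M * norm (z - w) ^ Suc 3 / fact 3"
    by (rule field_Taylor[OF \<open>convex S\<close>])
       (use assms in \<open>auto simp: le_Suc_eq numeral_2_eq_2 numeral_3_eq_3\<close>)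
  then show ?thesis by (simp add: numeral_2_eq_2 numeral_3_eq_3 eval_nat_numeral algebra_simps)
qed

text \<open>The central scheme, multiplied by the mean step, in the layer variable.\<close>

definition central_residual ::
  "(real \<Rightarrow> real) \<Rightarrow> (real \<Rightarrow> real) \<Rightarrow> real \<Rightarrow> real \<Rightarrow> real \<Rightarrow> real" where
  "central_residual F v t s s' =
     - ((v (t - s) - v t) / s + (v (t + s') - v t) / s')
     - ((t + s') * F (v (t + s')) - (t - s) * F (v (t - s))) / 2 + (s + s') / 2 * F (v t)"

lemma abs_diff_divide_le:
  fixes s :: real
  assumes "\<bar>a - c\<bar> \<le> e * s" "0 < s"
  shows "\<bar>a / s - c / s\<bar> \<le> e"
  using assms by (simp add: diff_divide_distrib[symmetric] abs_divide pos_divide_le_eq)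

lemma abs_combination_le:
  fixes x y z w :: real
  assumes "\<bar>x\<bar> \<le> a" "\<bar>y\<bar> \<le> b" "\<bar>z\<bar> \<le> c" "\<bar>w\<bar> \<le> d"
  shows "\<bar>- x - y - z / 2 + w / 2\<bar> \<le> a + b + c / 2 + d / 2"
  using assms by linarith

text \<open>By the differential equation \<open>F (v t)\<close> is the sum of the flux derivative
  \<open>g1 t\<close> and of \<open>p1 t\<close>, so all terms of first order in the steps cancel on
  any mesh. With equal steps the second order terms cancel as well, by symmetry, which gains one
  power of \<open>s\<close>. The decaying exponential is evaluated at the leftmost point of the
  stencil, where it is largest.\<close>

lemma central_residual_bounds:
  assumes prof: "layer_profile F U_hi A m K R v" and "0 \<le> A"
    and "0 < s" "s \<le> s'" "0 \<le> t - s" "t + s' \<le> R"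
  shows "\<bar>central_residual F v t s s'\<bar> \<le> 2 * K * s'\<^sup>2 * exp (- (A * (t - s)))"
    and "s = s' \<Longrightarrow> \<bar>central_residual F v t s s'\<bar> \<le> K * s ^ 3 * exp (- (A * (t - s)))"
proof -
  let ?S = "{t - s..t + s'}"
  have sub: "?S \<subseteq> {0..R}" using assms by auto
  obtain p p1 p2 p3 g2 g3 where P: "\<And>t. t \<in> {0..R} \<Longrightarrow>
        (v has_real_derivative p t) (at t within {0..R}) \<and>
        (p has_real_derivative p1 t) (at t within {0..R}) \<and>
        (p1 has_real_derivative p2 t) (at t within {0..R}) \<and>
        (p2 has_real_derivative p3 t) (at t within {0..R}) \<and>
        ((\<lambda>t. t * F (v t)) has_real_derivative F (v t) - p1 t) (at t within {0..R}) \<and>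
        ((\<lambda>t. F (v t) - p1 t) has_real_derivative g2 t) (at t within {0..R}) \<and>
        (g2 has_real_derivative g3 t) (at t within {0..R}) \<and>
        \<bar>p2 t\<bar> \<le> K * exp (- (A * t)) \<and> \<bar>p3 t\<bar> \<le> K * exp (- (A * t)) \<and>
        \<bar>g2 t\<bar> \<le> K * exp (- (A * t)) \<and> \<bar>g3 t\<bar> \<le> K * exp (- (A * t))"
    using prof unfolding layer_profile_def by blast
  define g where "g = (\<lambda>t. t * F (v t))"
  define g1 where "g1 = (\<lambda>t. F (v t) - p1 t)"
  define M where "M = K * exp (- (A * (t - s)))"
  have "0 \<le> K * exp (- (A * t))" using P[of t] assms by force
  then have K: "0 \<le> K" by (simp add: zero_le_mult_iff)
  have mono: "K * exp (- (A * r)) \<le> M" if "r \<in> ?S" for r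
    unfolding M_def using K that \<open>0 \<le> A\<close> by (intro mult_left_mono) (auto simp: mult_left_mono)
  note D = DERIV_subset[OF _ sub]
  have d: "(v has_real_derivative p r) (at r within ?S)"
    "(p has_real_derivative p1 r) (at r within ?S)"
    "(p1 has_real_derivative p2 r) (at r within ?S)"
    "(p2 has_real_derivative p3 r) (at r within ?S)"
    "(g has_real_derivative g1 r) (at r within ?S)"
    "(g1 has_real_derivative g2 r) (at r within ?S)"
    "(g2 has_real_derivative g3 r) (at r within ?S)"
    "\<bar>p2 r\<bar> \<le> M" "\<bar>p3 r\<bar> \<le> M" "\<bar>g2 r\<bar> \<le> M" "\<bar>g3 r\<bar> \<le> M" if "r \<in> ?S" for r
  proof -
    have "r \<in> {0..R}" using that sub by blast
    note Q = P[OF this] note mo = mono[OF that]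
    show "(v has_real_derivative p r) (at r within ?S)"
      "(p has_real_derivative p1 r) (at r within ?S)"
      "(p1 has_real_derivative p2 r) (at r within ?S)"
      "(p2 has_real_derivative p3 r) (at r within ?S)"
      "(g has_real_derivative g1 r) (at r within ?S)"
      "(g1 has_real_derivative g2 r) (at r within ?S)"
      "(g2 has_real_derivative g3 r) (at r within ?S)"
      unfolding g_def g1_def using Q by (auto intro!: D)
    show "\<bar>p2 r\<bar> \<le> M" "\<bar>p3 r\<bar> \<le> M" "\<bar>g2 r\<bar> \<le> M" "\<bar>g3 r\<bar> \<le> M"
      using Q mo by linarith+
  qed
  have M: "0 \<le> M" using K by (simp add: M_def)
  have t: "t \<in> ?S" "t - s \<in> ?S" "t + s' \<in> ?S" and s': "0 < s'" using assms by auto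
  have res: "central_residual F v t s s' =
     - ((v (t - s) - v t) / s + (v (t + s') - v t) / s')
     - (g (t + s') - g (t - s)) / 2 + (s + s') / 2 * (g1 t + p1 t)"
    by (simp add: central_residual_def g_def g1_def)
  show "\<bar>central_residual F v t s s'\<bar> \<le> 2 * K * s'\<^sup>2 * exp (- (A * (t - s)))"
  proof -
    have V: "\<bar>v z - v t - p t * (z - t) - p1 t * (z - t)\<^sup>2 / 2\<bar> \<le> M * \<bar>z - t\<bar> ^ 3 / 2"
      if "z \<in> ?S" for z
      by (rule taylor_order3[OF d(1,2,3,8) _ t(1) that]) simp_all
    have G: "\<bar>g z - g t - g1 t * (z - t)\<bar> \<le> M * \<bar>z - t\<bar>\<^sup>2"
      if "z \<in> ?S" for z
      by (rule taylor_order2[OF d(5,6,10) _ t(1) that]) simp_all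
    have "\<bar>(v (t - s) - v t) - (- p t + p1 t * s / 2) * s\<bar> \<le> M * s\<^sup>2 / 2 * s"
      using V[OF t(2)] assms(3) by (simp add: algebra_simps power2_eq_square power3_eq_cube)
    from abs_diff_divide_le[OF this \<open>0 < s\<close>]
    have v1: "\<bar>(v (t - s) - v t) / s - (- p t + p1 t * s / 2)\<bar> \<le> M * s\<^sup>2 / 2"
      using \<open>0 < s\<close> by simp
    have "\<bar>(v (t + s') - v t) - (p t + p1 t * s' / 2) * s'\<bar> \<le> M * s'\<^sup>2 / 2 * s'"
      using V[OF t(3)] s' by (simp add: algebra_simps power2_eq_square power3_eq_cube)
    from abs_diff_divide_le[OF this s']
    have v2: "\<bar>(v (t + s') - v t) / s' - (p t + p1 t * s' / 2)\<bar> \<le> M * s'\<^sup>2 / 2"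
      using s' by simp
    have g1: "\<bar>g (t - s) - g t + g1 t * s\<bar> \<le> M * s\<^sup>2"
      using G[OF t(2)] assms(3) by simp
    have g2: "\<bar>g (t + s') - g t - g1 t * s'\<bar> \<le> M * s'\<^sup>2"
      using G[OF t(3)] s' by simp
    have "M * s\<^sup>2 \<le> M * s'\<^sup>2" using assms M by (intro mult_left_mono power_mono) auto
    moreover have eq: "central_residual F v t s s' =
        - ((v (t - s) - v t) / s - (- p t + p1 t * s / 2))
        - ((v (t + s') - v t) / s' - (p t + p1 t * s' / 2))
        - (g (t + s') - g t - g1 t * s') / 2 + (g (t - s) - g t + g1 t * s) / 2"
      unfolding res by (simp add: algebra_simps add_divide_distrib diff_divide_distrib)
    moreover have "\<bar>central_residual F v t s s'\<bar>
        \<le> M * s\<^sup>2 / 2 + M * s'\<^sup>2 / 2 + M * s'\<^sup>2 / 2 + M * s\<^sup>2 / 2"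
      unfolding eq by (rule abs_combination_le[OF v1 v2 g2 g1])
    ultimately have "\<bar>central_residual F v t s s'\<bar> \<le> 2 * (M * s'\<^sup>2)" by linarith
    then show ?thesis by (simp add: M_def mult_ac)
  qed
  assume eq: "s = s'"
  have V: "\<bar>v z - v t - p t * (z - t) - p1 t * (z - t)\<^sup>2 / 2 - p2 t * (z - t) ^ 3 / 6\<bar>
      \<le> M * \<bar>z - t\<bar> ^ 4 / 6"
    if "z \<in> ?S" for z
    by (rule taylor_order4[OF d(1,2,3,4,9) _ t(1) that]) simp_all
  have G: "\<bar>g z - g t - g1 t * (z - t) - g2 t * (z - t)\<^sup>2 / 2\<bar> \<le> M * \<bar>z - t\<bar> ^ 3 / 2"
    if "z \<in> ?S" for z
    by (rule taylor_order3[OF d(5,6,7,11) _ t(1) that]) simp_all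
  have "\<bar>(v (t - s) - v t) - (- p t + p1 t * s / 2 - p2 t * s\<^sup>2 / 6) * s\<bar> \<le> M * s ^ 3 / 6 * s"
    using V[OF t(2)] assms(3)
    by (simp add: algebra_simps power2_eq_square power3_eq_cube power4_eq_xxxx)
  from abs_diff_divide_le[OF this \<open>0 < s\<close>]
  have v1: "\<bar>(v (t - s) - v t) / s - (- p t + p1 t * s / 2 - p2 t * s\<^sup>2 / 6)\<bar> \<le> M * s ^ 3 / 6"
    using \<open>0 < s\<close> by simp
  have "\<bar>(v (t + s) - v t) - (p t + p1 t * s / 2 + p2 t * s\<^sup>2 / 6) * s\<bar> \<le> M * s ^ 3 / 6 * s"
    using V[OF t(3)] assms(3) eq
    by (simp add: algebra_simps power2_eq_square power3_eq_cube power4_eq_xxxx)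
  from abs_diff_divide_le[OF this \<open>0 < s\<close>]
  have v2: "\<bar>(v (t + s) - v t) / s - (p t + p1 t * s / 2 + p2 t * s\<^sup>2 / 6)\<bar> \<le> M * s ^ 3 / 6"
    using \<open>0 < s\<close> by simp
  have gl: "\<bar>g (t - s) - g t + g1 t * s - g2 t * s\<^sup>2 / 2\<bar> \<le> M * s ^ 3 / 2"
    using G[OF t(2)] assms(3) by simp
  have gr: "\<bar>g (t + s) - g t - g1 t * s - g2 t * s\<^sup>2 / 2\<bar> \<le> M * s ^ 3 / 2"
    using G[OF t(3)] assms(3) eq by simp
  \<comment> \<open>The terms with \<open>p2 t\<close> enter the two difference quotients with
    opposite signs, and those with \<open>g2 t\<close> enter both flux values with the same sign, so
    they may be inserted without changing the sum.\<close>
  have res': "central_residual F v t s s' =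
      - ((v (t - s) - v t) / s - (- p t + p1 t * s / 2 - p2 t * s\<^sup>2 / 6))
      - ((v (t + s) - v t) / s - (p t + p1 t * s / 2 + p2 t * s\<^sup>2 / 6))
      - (g (t + s) - g t - g1 t * s - g2 t * s\<^sup>2 / 2) / 2
      + (g (t - s) - g t + g1 t * s - g2 t * s\<^sup>2 / 2) / 2"
    unfolding res unfolding eq[symmetric] using assms(3)
    by (simp add: algebra_simps add_divide_distrib diff_divide_distrib)
  have "\<bar>central_residual F v t s s'\<bar> \<le> M * s ^ 3 / 6 + M * s ^ 3 / 6 + M * s ^ 3 / 2 / 2 + M * s ^ 3 / 2 / 2"
    unfolding res' by (rule abs_combination_le[OF v1 v2 gr gl])
  moreover have "0 \<le> M * s ^ 3" using M assms(3) by simp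
  ultimately have "\<bar>central_residual F v t s s'\<bar> \<le> M * s ^ 3" by linarith
  then show "\<bar>central_residual F v t s s'\<bar> \<le> K * s ^ 3 * exp (- (A * (t - s)))"
    by (simp add: M_def mult_ac)
qed

section \<open>Stability of the scheme in the discrete norm\<close>

lemma sum_shift_down:
  fixes f :: "nat \<Rightarrow> real"
  shows "(\<Sum>i=1..k. f (i - 1)) = f 0 + (\<Sum>i=1..k. f i) - f k"
  by (induction k) auto

lemma sum_shift_up:
  fixes f :: "nat \<Rightarrow> real"
  shows "(\<Sum>i=1..k. f (i + 1)) = f (k + 1) + (\<Sum>i=1..k. f i) - f 1"
  by (induction k) auto

text \<open>The weights \<open>y\<close> vanish in the fictitious rows \<open>0\<close> and \<open>N\<close>, so that all columns can be
  treated alike.\<close>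

lemma weighted_column_sums:
  fixes z d lo up y \<kappa> :: "nat \<Rightarrow> real"
  assumes N: "1 \<le> N" and z: "z 0 = 0" "z N = 0" and y: "y 0 = 0" "y N = 0"
    and nn: "\<And>i. i \<in> {1..N-1} \<Longrightarrow> 0 \<le> lo i \<and> 0 \<le> up i \<and> 0 \<le> y i"
    and col: "\<And>j. j \<in> {1..N-1} \<Longrightarrow>
      \<kappa> j \<le> y j * d j - y (j + 1) * lo (j + 1) - y (j - 1) * up (j - 1)"
  shows "(\<Sum>j=1..N-1. \<kappa> j * \<bar>z j\<bar>)
    \<le> (\<Sum>i=1..N-1. y i * \<bar>d i * z i - lo i * z (i - 1) - up i * z (i + 1)\<bar>)"
proof -
  have "(\<Sum>j=1..N-1. \<kappa> j * \<bar>z j\<bar>)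
      \<le> (\<Sum>j=1..N-1. (y j * d j - y (j + 1) * lo (j + 1) - y (j - 1) * up (j - 1)) * \<bar>z j\<bar>)"
    using col by (intro sum_mono mult_right_mono) auto
  also have "\<dots> = (\<Sum>j=1..N-1. y j * d j * \<bar>z j\<bar>)
      - (\<Sum>j=1..N-1. y (j + 1) * lo (j + 1) * \<bar>z (j + 1 - 1)\<bar>)
      - (\<Sum>j=1..N-1. y (j - 1) * up (j - 1) * \<bar>z (j - 1 + 1)\<bar>)"
    unfolding sum_subtractf[symmetric] by (intro sum.cong) (auto simp: algebra_simps)
  \<comment> \<open>Summation by columns becomes summation by rows. The end terms of each shift
    vanish: at one end because of the weight \<open>y\<close>, at the other because of
    \<open>z\<close>.\<close>
  also have "(\<Sum>j=1..N-1. y (j + 1) * lo (j + 1) * \<bar>z (j + 1 - 1)\<bar>)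
      = (\<Sum>i=1..N-1. y i * lo i * \<bar>z (i - 1)\<bar>)"
    using sum_shift_up[of "\<lambda>i. y i * lo i * \<bar>z (i - 1)\<bar>" "N - 1"] N z y by simp
  also have "(\<Sum>j=1..N-1. y (j - 1) * up (j - 1) * \<bar>z (j - 1 + 1)\<bar>)
      = (\<Sum>i=1..N-1. y i * up i * \<bar>z (i + 1)\<bar>)"
    using sum_shift_down[of "\<lambda>i. y i * up i * \<bar>z (i + 1)\<bar>" "N - 1"] N z y by simp
  also have "(\<Sum>i=1..N-1. y i * d i * \<bar>z i\<bar>) - (\<Sum>i=1..N-1. y i * lo i * \<bar>z (i - 1)\<bar>)
      - (\<Sum>i=1..N-1. y i * up i * \<bar>z (i + 1)\<bar>)
    = (\<Sum>i=1..N-1. y i * (d i * \<bar>z i\<bar> - lo i * \<bar>z (i - 1)\<bar> - up i * \<bar>z (i + 1)\<bar>))"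
    unfolding sum_subtractf[symmetric] by (intro sum.cong) (auto simp: algebra_simps)
  \<comment> \<open>The reverse triangle inequality within each row; this is where the signs of the
    off-diagonal entries matter.\<close>
  also have "\<dots> \<le> (\<Sum>i=1..N-1. y i * \<bar>d i * z i - lo i * z (i - 1) - up i * z (i + 1)\<bar>)"
  proof (intro sum_mono mult_left_mono)
    fix i assume i: "i \<in> {1..N-1}"
    have "d i * \<bar>z i\<bar> \<le> \<bar>d i * z i\<bar>" by (simp add: abs_mult mult_right_mono)
    moreover have "\<bar>lo i * z (i - 1)\<bar> = lo i * \<bar>z (i - 1)\<bar>" "\<bar>up i * z (i + 1)\<bar> = up i * \<bar>z (i + 1)\<bar>"
      using nn[OF i] by (simp_all add: abs_mult)
    ultimately show "d i * \<bar>z i\<bar> - lo i * \<bar>z (i - 1)\<bar> - up i * \<bar>z (i + 1)\<bar>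
        \<le> \<bar>d i * z i - lo i * z (i - 1) - up i * z (i + 1)\<bar>" by linarith
    show "0 \<le> y i" using nn[OF i] by simp
  qed
  finally show ?thesis .
qed

text \<open>The predicates follow the order of cases in \<open>T_op\<close>, where
  \<open>n = 1\<close> is tested first; a row that is neither central nor a transition row carries
  the scheme \<open>T_plus\<close>.\<close>

definition central_row :: "nat \<Rightarrow> nat \<Rightarrow> nat \<Rightarrow> bool" where
  "central_row n N i \<longleftrightarrow> n \<noteq> 1 \<and> (n = N - 1 \<or> i < n)"

definition transition_row :: "nat \<Rightarrow> nat \<Rightarrow> nat \<Rightarrow> bool" where
  "transition_row n N i \<longleftrightarrow> n \<noteq> 1 \<and> n \<noteq> N - 1 \<and> i = n"

text \<open>Multiplied by \<open>chi\<close>, all three schemes have the common form of \<open>chi_T_op\<close> below, with the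
  weights \<open>flux_next\<close>, \<open>flux_here\<close>, \<open>flux_prev\<close> of the flux and \<open>source_here\<close>, \<open>source_next\<close>
  of its partial derivative.\<close>

definition flux_next :: "nat \<Rightarrow> nat \<Rightarrow> nat \<Rightarrow> real" where
  "flux_next n N i = (if central_row n N i then 1 / 2 else 1)"

definition flux_here :: "nat \<Rightarrow> nat \<Rightarrow> nat \<Rightarrow> real" where
  "flux_here n N i = (if central_row n N i then 0 else if transition_row n N i then 1 / 2 else 1)"

definition flux_prev :: "nat \<Rightarrow> nat \<Rightarrow> nat \<Rightarrow> real" where
  "flux_prev n N i = (if central_row n N i \<or> transition_row n N i then 1 / 2 else 0)"

definition source_here :: "nat \<Rightarrow> nat \<Rightarrow> (nat \<Rightarrow> real) \<Rightarrow> nat \<Rightarrow> real" where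
  "source_here n N x i =
     (if central_row n N i \<or> transition_row n N i then chi n N x i else step x (i + 1) / 2)"

definition source_next :: "nat \<Rightarrow> nat \<Rightarrow> (nat \<Rightarrow> real) \<Rightarrow> nat \<Rightarrow> real" where
  "source_next n N x i =
     (if central_row n N i \<or> transition_row n N i then 0 else step x (i + 1) / 2)"

lemma flux_x_indep: "flux_x b U_hi y v = flux_x b U_hi 0 v"
  by (simp add: flux_x_def)

lemma flux_eq: "flux b U_hi y v = y * flux_x b U_hi 0 v"
  by (simp add: flux_def flux_x_def)

lemma chi_T_op:
  fixes b :: "real \<Rightarrow> real" and U_hi :: real
  defines "F \<equiv> flux_x b U_hi 0"
  assumes "chi n N x i \<noteq> 0" "step x (i + 1) \<noteq> 0" "avg_step x i \<noteq> 0"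
  shows "chi n N x i * T_op b U_hi \<epsilon> n N x w i =
    \<epsilon>\<^sup>2 * ((w i - w (i - 1)) / step x i + (w i - w (i + 1)) / step x (i + 1))
    - (flux_next n N i * x (i + 1) * F (w (i + 1)) - flux_here n N i * x i * F (w i)
        - flux_prev n N i * x (i - 1) * F (w (i - 1)))
    + source_here n N x i * F (w i) + source_next n N x i * F (w (i + 1))"
proof -
  have D2: "chi n N x i * (- (\<epsilon>\<^sup>2) * D2 n N x w i)
      = \<epsilon>\<^sup>2 * ((w i - w (i - 1)) / step x i + (w i - w (i + 1)) / step x (i + 1))"
    using assms(2) by (simp add: D2_def diff_divide_distrib algebra_simps)
  consider (c) "central_row n N i" | (t) "transition_row n N i" "\<not> central_row n N i"
    | (p) "\<not> central_row n N i" "\<not> transition_row n N i" by blast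
  then show ?thesis
  proof cases
    case c
    then have "chi n N x i = avg_step x i" "T_op b U_hi \<epsilon> n N x w i = T_central b U_hi \<epsilon> n N x w i"
      by (auto simp: central_row_def chi_def T_op_def)
    then have "chi n N x i * T_op b U_hi \<epsilon> n N x w i = chi n N x i * (- (\<epsilon>\<^sup>2) * D2 n N x w i)
        - avg_step x i * ((x (i + 1) * F (w (i + 1)) - x (i - 1) * F (w (i - 1))) / (2 * avg_step x i))
        + avg_step x i * F (w i)"
      unfolding T_central_def flux_eq flux_x_indep[of b U_hi "x _"] F_def[symmetric]
      by (simp only:) (simp add: algebra_simps)
    then show ?thesis unfolding D2 using c assms(4) \<open>chi n N x i = avg_step x i\<close>
      by (simp add: flux_next_def flux_here_def flux_prev_def source_here_def source_next_def)
         (simp add: diff_divide_distrib)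
  next
    case t
    then have "T_op b U_hi \<epsilon> n N x w i = T_transition b U_hi \<epsilon> n N x w i"
      by (auto simp: transition_row_def T_op_def)
    then have "chi n N x i * T_op b U_hi \<epsilon> n N x w i = chi n N x i * (- (\<epsilon>\<^sup>2) * D2 n N x w i)
        - chi n N x i * ((2 * (x (i + 1) * F (w (i + 1))) - x i * F (w i)
            - x (i - 1) * F (w (i - 1))) / (2 * chi n N x i))
        + chi n N x i * F (w i)"
      unfolding T_transition_def flux_eq flux_x_indep[of b U_hi "x _"] F_def[symmetric]
      by (simp only:) (simp add: algebra_simps)
    then show ?thesis unfolding D2 using t assms(2)
      by (simp add: flux_next_def flux_here_def flux_prev_def source_here_def source_next_def)
         (simp add: diff_divide_distrib)
  next
    case p
    then have "chi n N x i = step x (i + 1)" "T_op b U_hi \<epsilon> n N x w i = T_plus b U_hi \<epsilon> n N x w i"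
      by (auto simp: central_row_def transition_row_def chi_def T_op_def)
    then have "chi n N x i * T_op b U_hi \<epsilon> n N x w i = chi n N x i * (- (\<epsilon>\<^sup>2) * D2 n N x w i)
        - step x (i + 1) * ((x (i + 1) * F (w (i + 1)) - x i * F (w i)) / step x (i + 1))
        + step x (i + 1) * ((F (w (i + 1)) + F (w i)) / 2)"
      unfolding T_plus_def flux_eq flux_x_indep[of b U_hi "x _"] F_def[symmetric]
      by (simp only:) (simp add: algebra_simps)
    then show ?thesis unfolding D2 using p assms(3)
      by (simp add: flux_next_def flux_here_def flux_prev_def source_here_def source_next_def)
         (simp add: add_divide_distrib algebra_simps)
  qed
qed

text \<open>The linear system for the difference of two mesh functions: \<open>e\<close> stands for
  the squared \<epsilon>, and \<open>\<beta> i\<close> for the difference quotient of the primitive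
  of \<open>b\<close> between the two values at node \<open>i\<close>. The mesh ratio is controlled
  only up to the switching index.\<close>

locale hybrid_scheme =
  fixes b_lo b_hi e :: real and N n :: nat and x \<beta> :: "nat \<Rightarrow> real"
  assumes b_lo: "0 < b_lo" and e: "0 < e" and N: "3 \<le> N" and n: "1 \<le> n" "n \<le> N - 1"
    and x0: "x 0 = 0" and step_pos: "\<And>i. \<lbrakk>1 \<le> i; i \<le> N\<rbrakk> \<Longrightarrow> 0 < step x i"
    and ratio: "\<And>i. \<lbrakk>1 \<le> i; i \<le> n\<rbrakk> \<Longrightarrow> b_hi * x (i - 1) * step x i \<le> 2 * e"
    and \<beta>: "\<And>i. b_lo \<le> \<beta> i \<and> \<beta> i \<le> b_hi"
begin

text \<open>The off-diagonal entries are stored with reversed sign, so that nonnegative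
  \<open>lower\<close> and \<open>upper\<close> express the sign pattern of an M-matrix.\<close>

definition lower :: "nat \<Rightarrow> real" where
  "lower i = e / step x i - flux_prev n N i * x (i - 1) * \<beta> (i - 1)"

definition upper :: "nat \<Rightarrow> real" where
  "upper i = e / step x (i + 1) + flux_next n N i * x (i + 1) * \<beta> (i + 1)
     - source_next n N x i * \<beta> (i + 1)"

definition diag :: "nat \<Rightarrow> real" where
  "diag i = e / step x i + e / step x (i + 1)
     + (flux_here n N i * x i + source_here n N x i) * \<beta> i"

lemma x_Suc: "x (Suc i) = x i + step x (Suc i)"
  by (simp add: step_def)

lemma x_nonneg: "i \<le> N \<Longrightarrow> 0 \<le> x i"
proof (induction i)
  case (Suc i)
  then show ?case using step_pos[of "Suc i"] x_Suc[of i] by simp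
qed (simp add: x0)

lemma step_pos_interior:
  assumes "i \<le> N - 1"
  shows "0 < step x (Suc i)" and "1 \<le> i \<Longrightarrow> 0 < step x i"
  using assms N step_pos[of "Suc i"] step_pos[of i] by auto

lemma b_hi_pos: "0 < b_hi"
  using b_lo \<beta>[of 0] by linarith

text \<open>This is the purpose of the switching index: rows that use the flux at the left neighbour
  have \<open>i \<le> n\<close>, and there the mesh ratio says that diffusion dominates half of that
  flux.\<close>

lemma lower_nonneg:
  assumes "1 \<le> i" "i \<le> N - 1"
  shows "0 \<le> lower i"
proof (cases "flux_prev n N i = 0")
  case True
  then show ?thesis using e step_pos_interior(2)[OF assms(2,1)] by (simp add: lower_def)
next
  case False
  then have fp: "flux_prev n N i = 1 / 2" and i: "i \<le> n"
    using assms by (auto simp: flux_prev_def central_row_def transition_row_def split: if_splits)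
  have "x (i - 1) * \<beta> (i - 1) \<le> x (i - 1) * b_hi"
    using x_nonneg[of "i - 1"] assms \<beta> by (intro mult_left_mono) auto
  also have "\<dots> \<le> 2 * e / step x i"
    using ratio[OF assms(1) i] step_pos_interior(2)[OF assms(2,1)] by (simp add: field_simps)
  finally show ?thesis by (simp add: lower_def fp mult.commute)
qed

lemma source_next_nonneg: "i \<le> N - 1 \<Longrightarrow> 0 \<le> source_next n N x i"
  using step_pos_interior(1)[of i] by (simp add: source_next_def)

text \<open>A source term at the right neighbour occurs only in \<open>T_plus\<close> rows, where
  half a step is outweighed by the flux weight \<open>x (i + 1)\<close>, which is at least one
  step.\<close>

lemma upper_ge:
  assumes "i \<le> N - 1"
  shows "e / step x (i + 1) \<le> upper i"
proof -
  have "0 < step x (i + 1)" "0 \<le> x i" using step_pos_interior(1)[OF assms] x_nonneg[of i] assms by auto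
  then have "source_next n N x i \<le> flux_next n N i * x (i + 1)"
    using x_Suc[of i] by (simp add: source_next_def flux_next_def)
  then have "source_next n N x i * \<beta> (i + 1) \<le> flux_next n N i * x (i + 1) * \<beta> (i + 1)"
    using \<beta>[of "i + 1"] b_lo by (intro mult_right_mono) auto
  then show ?thesis by (simp add: upper_def)
qed

lemma upper_nonneg: "i \<le> N - 1 \<Longrightarrow> 0 \<le> upper i"
  by (rule order_trans[OF divide_nonneg_pos upper_ge]) (use e step_pos_interior(1)[of i] in auto)

text \<open>Conservation: the flux at node \<open>j\<close> cancels when the rows
  \<open>j - 1\<close>, \<open>j\<close>, \<open>j + 1\<close> are added. The weights of the
  transition row are what keeps this true where the half weights of the central scheme meet the unit
  weights of \<open>T_plus\<close>. Rows \<open>0\<close> and \<open>N\<close> are fictitious and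
  follow the same formulas.\<close>

lemma flux_balance:
  assumes "1 \<le> j" "j \<le> N - 1"
  shows "flux_here n N j + flux_prev n N (j + 1) = flux_next n N (j - 1)"
  using assms n N
  by (auto simp: flux_here_def flux_prev_def flux_next_def central_row_def transition_row_def)

text \<open>Diffusion and flux telescope, so only the source weights survive. For
  \<open>j = N - 1\<close> the sum includes the fictitious entry \<open>lower N\<close>, whose sign
  is not covered by \<open>lower_nonneg\<close>.\<close>

lemma column_sum:
  assumes "1 \<le> j" "j \<le> N - 1"
  shows "diag j - lower (j + 1) - upper (j - 1)
    = (source_here n N x j + source_next n N x (j - 1)) * \<beta> j"
proof -
  have "flux_here n N j = flux_next n N (j - 1) - flux_prev n N (j + 1)"
    using flux_balance[OF assms] by simp
  then show ?thesis using assms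
    by (simp only: diag_def lower_def upper_def) (simp add: algebra_simps)
qed

lemma chi_pos:
  assumes "1 \<le> j" "j \<le> N - 1"
  shows "0 < chi n N x j"
  using step_pos_interior[OF assms(2)] assms(1) by (auto simp: chi_def avg_step_def)

lemma chi_le_source:
  assumes "1 \<le> j" "j \<le> N - 1"
  shows "chi n N x j \<le> 2 * source_here n N x j"
proof (cases "central_row n N j \<or> transition_row n N j")
  case True
  then show ?thesis using chi_pos[OF assms] by (simp add: source_here_def)
next
  case False
  then show ?thesis
    by (auto simp: source_here_def chi_def central_row_def transition_row_def)
qed

lemma column_sum_ge:
  assumes "1 \<le> j" "j \<le> N - 1"
  shows "b_lo / 2 * chi n N x j \<le> diag j - lower (j + 1) - upper (j - 1)"
proof -
  have "0 \<le> source_next n N x (j - 1)" using source_next_nonneg[of "j - 1"] assms by simp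
  then have S: "chi n N x j / 2 \<le> source_here n N x j + source_next n N x (j - 1)"
    using chi_le_source[OF assms] by simp
  then have "b_lo * (chi n N x j / 2) \<le> b_lo * (source_here n N x j + source_next n N x (j - 1))"
    using b_lo by (intro mult_left_mono) auto
  also have "\<dots> \<le> (source_here n N x j + source_next n N x (j - 1)) * \<beta> j"
    using S chi_pos[OF assms] \<beta>[of j] by (subst mult.commute, intro mult_left_mono) auto
  finally show ?thesis using column_sum[OF assms] by simp
qed

abbreviation row :: "(nat \<Rightarrow> real) \<Rightarrow> nat \<Rightarrow> real" where
  "row z i \<equiv> diag i * z i - lower i * z (i - 1) - upper i * z (i + 1)"

text \<open>Unit weights suffice: omitting the fictitious rows removes only nonnegative entries from
  the columns \<open>1\<close> and \<open>N - 1\<close>.\<close>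

lemma stability_dominant:
  assumes "z 0 = 0" "z N = 0" and "0 \<le> lower N"
  shows "b_lo / 2 * norm_H n N x z \<le> (\<Sum>i=1..N-1. \<bar>row z i\<bar>)"
proof -
  define y :: "nat \<Rightarrow> real" where "y i = (if 1 \<le> i \<and> i < N then 1 else 0)" for i
  have "(\<Sum>j=1..N-1. b_lo / 2 * chi n N x j * \<bar>z j\<bar>) \<le> (\<Sum>i=1..N-1. y i * \<bar>row z i\<bar>)"
  proof (rule weighted_column_sums)
    fix j assume j: "j \<in> {1..N-1}"
    have "y (j + 1) * lower (j + 1) \<le> lower (j + 1)"
      using j lower_nonneg[of "j + 1"] assms(3) by (cases "j + 1 = N") (auto simp: y_def)
    moreover have "y (j - 1) * upper (j - 1) \<le> upper (j - 1)"
      using j upper_nonneg[of "j - 1"] by (auto simp: y_def)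
    moreover have "y j = 1" using j by (auto simp: y_def)
    ultimately show "b_lo / 2 * chi n N x j
        \<le> y j * diag j - y (j + 1) * lower (j + 1) - y (j - 1) * upper (j - 1)"
      using column_sum_ge[of j] j by simp
  qed (use N assms lower_nonneg upper_nonneg in \<open>auto simp: y_def\<close>)
  also have "\<dots> = (\<Sum>i=1..N-1. \<bar>row z i\<bar>)"
    by (intro sum.cong) (auto simp: y_def)
  finally show ?thesis by (simp add: norm_H_def sum_distrib_left mult.assoc)
qed

text \<open>If all rows are central, the last column sum may be negative, though not below
  \<open>- b_hi * h / 2\<close>. Increasing the weights geometrically over the last \<open>M + 1\<close> rows
  compensates this.\<close>

lemma stability_not_dominant:
  fixes M :: nat and h :: real
  defines "q \<equiv> (2 * b_hi - b_lo) / (2 * b_hi + b_lo)"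
  assumes z: "z 0 = 0" "z N = 0" and neg: "lower N < 0"
    and M: "q ^ M \<le> b_lo / (8 * b_hi)" and NM: "M + 3 \<le> N"
    and unif: "\<And>j. \<lbrakk>N - 2 - M \<le> j; j \<le> N\<rbrakk> \<Longrightarrow> step x j = h"
    and xN: "x N = 1" and h: "real (M + 2) * h \<le> 1 / 4"
  shows "b_lo / 4 * norm_H n N x z \<le> 2 * (\<Sum>i=1..N-1. \<bar>row z i\<bar>)"
proof -
  have hpos: "0 < h" using step_pos[of N] unif[of N] N by simp
  have blh: "b_lo \<le> b_hi" using \<beta>[of 0] by linarith
  have q: "0 < q" "q \<le> 1" using b_lo blh by (simp_all add: q_def field_simps)
  \<comment> \<open>A negative \<open>lower N\<close> needs a left flux weight in row
    \<open>N\<close>, which lies beyond \<open>n\<close>; this occurs only when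
    \<open>n = N - 1\<close>, the purely central case.\<close>
  have all_central: "central_row n N i" for i
  proof -
    have "0 \<le> e / step x N" using e step_pos[of N] N by (intro divide_nonneg_nonneg) auto
    then have "flux_prev n N N \<noteq> 0" using neg by (auto simp: lower_def)
    then show ?thesis using n N
      by (auto simp: flux_prev_def central_row_def transition_row_def split: if_splits)
  qed
  then have nN: "n = N - 1" using n by (auto simp: central_row_def dest: spec[of _ N])
  have fp: "flux_prev n N i = 1 / 2" "flux_next n N i = 1 / 2" "source_next n N x i = 0" for i
    using all_central by (simp_all add: flux_prev_def flux_next_def source_next_def)
  have chi: "chi n N x j = avg_step x j" for j
    using all_central[of j] by (auto simp: chi_def central_row_def)
  have xk: "x (N - k) = 1 - real k * h" if "k \<le> M + 2" for k
    using that
  proof (induction k)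
    case (Suc k)
    have "Suc (N - Suc k) = N - k" using Suc.prems NM by simp
    then have "x (N - k) = x (N - Suc k) + step x (N - k)" using x_Suc[of "N - Suc k"] by simp
    then show ?case using Suc unif[of "N - k"] NM by (simp add: algebra_simps)
  qed (simp add: xN)
  have x_ge: "3 / 4 \<le> x j" if "N - 2 - M \<le> j" "j \<le> N" for j
  proof -
    have "real (N - j) * h \<le> real (M + 2) * h" using that hpos by (intro mult_right_mono) auto
    then show ?thesis using xk[of "N - j"] that h by simp
  qed
  \<comment> \<open>The quotient \<open>e / h\<close> is now confined from both sides: above by the
    negative sign of \<open>lower N\<close>, below (in \<open>eh\<close> and \<open>eh_lo\<close>)
    by the mesh ratio in row \<open>N - 1\<close>, which is still at most one.\<close>
  have eh_hi: "e / h \<le> b_hi / 2"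
  proof -
    have "e / h < x (N - 1) * \<beta> (N - 1) / 2"
      using neg unif[of N] by (simp add: lower_def fp)
    also have "x (N - 1) * \<beta> (N - 1) \<le> 1 * b_hi"
      using xk[of 1] hpos \<beta>[of "N - 1"] x_nonneg[of "N - 1"] b_hi_pos b_lo by (intro mult_mono) auto
    finally show ?thesis by simp
  qed
  have eh: "b_hi * x (N - 2) / 2 \<le> e / h"
  proof -
    have "b_hi * x (N - 2) * h \<le> 2 * e"
      using ratio[of "N - 1"] unif[of "N - 1"] n nN N by (simp add: numeral_2_eq_2)
    then show ?thesis using hpos by (simp add: field_simps)
  qed
  have eh_lo: "b_hi / 4 \<le> e / h"
  proof -
    have "b_hi * (3 / 4) \<le> b_hi * x (N - 2)"
      using x_ge[of "N - 2"] b_hi_pos by (intro mult_left_mono) auto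
    then show ?thesis using eh b_hi_pos by linarith
  qed
  \<comment> \<open>The nodes \<open>N - 2\<close> and \<open>N - 1\<close> differ by only one step,
    so the inequality that holds in row \<open>N - 1\<close> fails in row \<open>N\<close> by at
    most a term of order \<open>h\<close>.\<close>
  have lowN: "- (b_hi * h / 2) \<le> lower N"
  proof -
    have "x (N - 1) = x (N - 2) + h" using xk[of 1] xk[of 2] by simp
    then have "x (N - 1) * b_hi = b_hi * x (N - 2) + b_hi * h"
      by (simp only:) (simp add: algebra_simps)
    moreover have "x (N - 1) * \<beta> (N - 1) \<le> x (N - 1) * b_hi"
      using \<beta>[of "N - 1"] x_nonneg[of "N - 1"] by (intro mult_left_mono) auto
    moreover have "lower N = e / h - x (N - 1) * \<beta> (N - 1) / 2"
      using unif[of N] by (simp add: lower_def fp)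
    ultimately show ?thesis using eh by linarith
  qed
  \<comment> \<open>The size \<open>4 * h\<close> is dictated by column \<open>N - 1\<close>:
    weights up to 2 turn the defect into at most \<open>b_hi * h\<close>, and the gain is
    \<open>4 * h\<close> times an entry of at least \<open>b_hi / 4\<close>. To the left the
    increments shrink by \<open>q\<close>, until the first one is so small that the column sum
    itself can pay for it.\<close>
  define \<delta> :: "nat \<Rightarrow> real" where
    "\<delta> k = (if N - 1 - M \<le> k \<and> k \<le> N - 1 then 4 * h * q ^ (N - 1 - k) else 0)" for k
  define y :: "nat \<Rightarrow> real" where
    "y j = (if 1 \<le> j \<and> j < N then 1 + (\<Sum>k\<le>j. \<delta> k) else 0)" for j
  have \<delta>: "0 \<le> \<delta> k" for k using hpos q by (simp add: \<delta>_def)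
  have y_ge: "1 \<le> y j" if "1 \<le> j" "j < N" for j
    using that \<delta> by (simp add: y_def sum_nonneg)
  have y_le: "y j \<le> 2" for j
  proof -
    have "(\<Sum>k\<le>j. \<delta> k) \<le> (\<Sum>k\<le>j. if k \<in> {N - 1 - M..N - 1} then 4 * h else 0)"
    proof (intro sum_mono)
      fix k
      have "q ^ (N - 1 - k) \<le> 1" using q by (simp add: power_le_one)
      then show "\<delta> k \<le> (if k \<in> {N - 1 - M..N - 1} then 4 * h else 0)"
        using hpos by (auto simp: \<delta>_def)
    qed
    also have "\<dots> = real (card ({..j} \<inter> {N - 1 - M..N - 1})) * (4 * h)"
      by (simp add: sum.If_cases Int_def)
    also have "\<dots> \<le> real (M + 1) * (4 * h)"
    proof -
      have "card ({..j} \<inter> {N - 1 - M..N - 1}) \<le> card {N - 1 - M..N - 1}" by (intro card_mono) auto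
      also have "\<dots> = M + 1" using NM by simp
      finally show ?thesis using hpos by (intro mult_right_mono) auto
    qed
    also have "\<dots> \<le> 1" using h hpos by (simp add: algebra_simps)
    finally show ?thesis by (simp add: y_def)
  qed
  have "(\<Sum>j=1..N-1. b_lo / 4 * chi n N x j * \<bar>z j\<bar>) \<le> (\<Sum>i=1..N-1. y i * \<bar>row z i\<bar>)"
  proof (rule weighted_column_sums)
    fix j assume "j \<in> {1..N-1}"
    then have j: "1 \<le> j" "j \<le> N - 1" by auto
    have c0: "0 \<le> b_lo / 2 * chi n N x j" using b_lo chi_pos[OF j] by simp
    have yj: "1 \<le> y j" using y_ge[of j] j by simp
    have up: "0 \<le> upper (j - 1)" using upper_nonneg[of "j - 1"] j by simp
    have "b_lo / 2 * chi n N x j \<le> y j * (diag j - lower (j + 1) - upper (j - 1))"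
      using mult_mono[OF yj column_sum_ge[OF j]] c0 yj by simp
    then have main: "b_lo / 2 * chi n N x j + y j * lower (j + 1) + y j * upper (j - 1) \<le> y j * diag j"
      by (simp add: algebra_simps)
    have "y (j - 1) \<le> y j - \<delta> j"
    proof (cases "j = 1")
      case True
      then show ?thesis using \<delta>[of 0] N by (simp add: y_def)
    next
      case False
      then have "j = Suc (j - 1)" "1 \<le> j - 1" using j by auto
      then show ?thesis using j sum.atMost_Suc[of \<delta> "j - 1"] by (auto simp: y_def)
    qed
    then have prev: "y (j - 1) * upper (j - 1) \<le> (y j - \<delta> j) * upper (j - 1)"
      using up by (rule mult_right_mono)
    show "b_lo / 4 * chi n N x j
        \<le> y j * diag j - y (j + 1) * lower (j + 1) - y (j - 1) * upper (j - 1)"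
    proof (cases "j = N - 1")
      case True
      then have j1: "j + 1 = N" using N by simp
      have "e / h \<le> upper (j - 1)"
      proof -
        have "N - 2 - M \<le> j" "j \<le> N" "j - 1 \<le> N - 1" using True by linarith+
        then show ?thesis using upper_ge[of "j - 1"] j(1) unif[of j] by simp
      qed
      then have "b_hi / 4 \<le> upper (j - 1)" using eh_lo by linarith
      then have "4 * h * (b_hi / 4) \<le> \<delta> j * upper (j - 1)"
      proof -
        have "N - 1 - M \<le> j" using True by linarith
        then have "\<delta> j = 4 * h" using True by (simp add: \<delta>_def)
        then show ?thesis using \<open>b_hi / 4 \<le> upper (j - 1)\<close> hpos b_hi_pos by (intro mult_mono) auto
      qed
      moreover have "- (b_hi * h) \<le> y j * lower N"
      proof -
        have "y j * - lower N \<le> 2 * (b_hi * h / 2)"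
          using y_le[of j] lowN neg yj by (intro mult_mono) auto
        then show ?thesis by simp
      qed
      moreover have "y (j + 1) = 0" using j1 by (simp add: y_def)
      ultimately show ?thesis using main prev c0 j1 by (simp add: algebra_simps)
    next
      case False
      then have j1: "j + 1 \<le> N - 1" using j by simp
      have next': "y (j + 1) = y j + \<delta> (j + 1)" using j j1 by (simp add: y_def)
      have lo: "0 \<le> lower (j + 1)" using lower_nonneg[of "j + 1"] j1 by simp
      \<comment> \<open>Relative to constant weights, the larger weight of the next row costs the
        left-hand side, and the smaller weight of the previous row gains
        \<open>\<delta> j * upper (j - 1)\<close>. Half of the column sum,
        \<open>b_lo / 4 * chi n N x j\<close>, may be spent. The cases are: left of the increments,
        at the first increment, and among them.\<close>
      have key: "\<delta> (j + 1) * lower (j + 1) \<le> b_lo / 4 * chi n N x j + \<delta> j * upper (j - 1)"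
      proof -
        consider "j + 1 < N - 1 - M" | "j = N - 2 - M" | "N - 1 - M \<le> j" using NM by linarith
        then show ?thesis
        proof cases
          case 1
          then have "\<not> N - 1 - M \<le> j + 1" by linarith
          then have "\<delta> (j + 1) = 0" by (simp add: \<delta>_def)
          then show ?thesis using c0 \<delta>[of j] up b_lo chi_pos[OF j] by simp
        next
          case 2
          then have "N - 1 - M \<le> j + 1" "j + 1 \<le> N - 1" "N - 1 - (j + 1) = M" using NM by linarith+
          then have "\<delta> (j + 1) = 4 * h * q ^ M" by (simp add: \<delta>_def)
          also have "\<dots> \<le> 4 * h * (b_lo / (8 * b_hi))" using M hpos by (intro mult_left_mono) auto
          finally have d: "\<delta> (j + 1) \<le> h * b_lo / (2 * b_hi)" by (simp add: mult.commute)
          have sj: "step x j = h" "step x (j + 1) = h" using 2 j j1 by (intro unif; linarith)+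
          have "lower (j + 1) \<le> e / h"
            using sj x_nonneg[of j] j \<beta>[of j] b_lo by (simp add: lower_def fp)
          then have "lower (j + 1) \<le> b_hi / 2" using eh_hi by linarith
          then have "\<delta> (j + 1) * lower (j + 1) \<le> h * b_lo / (2 * b_hi) * (b_hi / 2)"
            using d lo \<delta>[of "j + 1"] hpos b_lo b_hi_pos by (intro mult_mono) auto
          also have "\<dots> = b_lo / 4 * h" using b_hi_pos by simp
          also have "h = chi n N x j"
            using sj by (simp add: chi avg_step_def)
          finally show ?thesis using \<delta>[of j] up by (simp add: add_increasing2)
        next
          case 3
          have "N - 1 - j = Suc (N - 1 - (j + 1))" using j1 by simp
          moreover have "N - 1 - M \<le> j + 1" using 3 by linarith
          ultimately have dj: "\<delta> j = \<delta> (j + 1) * q" using 3 j j1 by (simp add: \<delta>_def)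
          have sj: "step x j = h" "step x (j + 1) = h" using 3 j j1 by (intro unif; linarith)+
          have jN: "N - 2 - M \<le> j" "j \<le> N" using 3 j by linarith+
          \<comment> \<open>\<open>q\<close> is the value of
            \<open>(e / h - X) / (e / h + X)\<close> at the extremes \<open>e / h = b_hi / 2\<close>
            and \<open>X = b_lo / 4\<close>; the quotient grows with \<open>e / h\<close> and falls
            with \<open>X\<close>.\<close>
          define X where "X = x j * \<beta> j / 2"
          have X: "b_lo / 4 \<le> X"
          proof -
            have "1 / 2 * b_lo \<le> x j * \<beta> j"
              using x_ge[OF jN] \<beta>[of j] b_lo by (intro mult_mono) auto
            then show ?thesis by (simp add: X_def)
          qed
          have l: "lower (j + 1) = e / h - X" and u: "upper (j - 1) = e / h + X"
            using sj j by (auto simp: lower_def upper_def fp X_def)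
          have "e / h * b_lo \<le> b_hi / 2 * b_lo" using eh_hi b_lo by (intro mult_right_mono) auto
          moreover have "b_lo / 4 * (2 * b_hi) \<le> X * (2 * b_hi)"
            using X b_hi_pos by (intro mult_right_mono) auto
          ultimately have "(e / h - X) * (2 * b_hi + b_lo) \<le> (2 * b_hi - b_lo) * (e / h + X)"
            by (simp add: algebra_simps)
          then have "lower (j + 1) \<le> q * upper (j - 1)"
            unfolding l u q_def using b_lo b_hi_pos by (simp add: pos_le_divide_eq)
          from mult_left_mono[OF this \<delta>[of "j + 1"]]
          have "\<delta> (j + 1) * lower (j + 1) \<le> \<delta> j * upper (j - 1)" by (simp add: dj mult.assoc)
          then show ?thesis using c0 by simp
        qed
      qed
      show ?thesis using main prev key unfolding next' by (simp add: algebra_simps)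
    qed
  qed (use N z lower_nonneg upper_nonneg y_ge in \<open>auto simp: y_def intro: add_nonneg_nonneg sum_nonneg \<delta>\<close>)
  also have "\<dots> \<le> (\<Sum>i=1..N-1. 2 * \<bar>row z i\<bar>)"
    using y_le by (intro sum_mono mult_right_mono) auto
  finally show ?thesis by (simp add: norm_H_def sum_distrib_left mult.assoc)
qed

end

lemma flux_x_difference_quotient:
  fixes b :: "real \<Rightarrow> real"
  assumes "continuous_on {U_lo..U_hi} b"
    and bnd: "\<And>v. v \<in> {U_lo..U_hi} \<Longrightarrow> b_lo \<le> b v \<and> b v \<le> b_hi"
    and pq: "p \<in> {U_lo..U_hi}" "q \<in> {U_lo..U_hi}"
  shows "\<exists>\<beta>. b_lo \<le> \<beta> \<and> \<beta> \<le> b_hi \<and> flux_x b U_hi y p - flux_x b U_hi y q = \<beta> * (p - q)"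
proof -
  have le: "U_lo \<le> U_hi" using pq by auto
  note der = flux_x_has_derivative[OF assms(1) le, of _ y]
  have lt: "\<exists>\<beta>. b_lo \<le> \<beta> \<and> \<beta> \<le> b_hi \<and> flux_x b U_hi y p - flux_x b U_hi y q = \<beta> * (p - q)"
    if "q < p" and mem: "p \<in> {U_lo..U_hi}" "q \<in> {U_lo..U_hi}" for p q
  proof -
    obtain r where "q < r" "r < p" "flux_x b U_hi y p - flux_x b U_hi y q = b r * (p - q)"
      by (rule mean_value_within[OF der _ \<open>q < p\<close>]) (use mem in auto)
    then show ?thesis using bnd[of r] mem by auto
  qed
  consider "p < q" | "p = q" | "q < p" by linarith
  then show ?thesis
  proof cases
    case 1
    from lt[OF this pq(2,1)] show ?thesis by (auto simp: algebra_simps)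
  next
    case 2
    then show ?thesis using bnd[OF pq(1)] by auto
  qed (rule lt[OF _ pq])
qed

text \<open>The nonlinear problem reduces to the linear one by difference quotients of the flux.
  \<open>u\<close> may be any mesh function with values in the given interval and the same boundary
  values. The constant \<open>8 / b_lo\<close> is that of the unfavourable case, two divided by
  \<open>b_lo / 4\<close>.\<close>

lemma stability:
  fixes b :: "real \<Rightarrow> real" and \<epsilon> h :: real and M N n :: nat and x w u :: "nat \<Rightarrow> real"
  assumes cont: "continuous_on {U_lo..U_hi} b" and b_lo: "0 < b_lo"
    and bnd: "\<And>v. v \<in> {U_lo..U_hi} \<Longrightarrow> b_lo \<le> b v \<and> b v \<le> b_hi"
    and M: "((2 * b_hi - b_lo) / (2 * b_hi + b_lo)) ^ M \<le> b_lo / (8 * b_hi)"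
    and \<epsilon>: "0 < \<epsilon>" and NM: "M + 3 \<le> N" and n: "1 \<le> n" "n \<le> N - 1"
    and x0: "x 0 = 0" and xN: "x N = 1"
    and step_pos: "\<And>i. \<lbrakk>1 \<le> i; i \<le> N\<rbrakk> \<Longrightarrow> 0 < step x i"
    and ratio: "\<And>i. \<lbrakk>1 \<le> i; i \<le> n\<rbrakk> \<Longrightarrow> mesh_ratio b_hi \<epsilon> x i \<le> 1"
    and unif: "\<And>j. \<lbrakk>N - 2 - M \<le> j; j \<le> N\<rbrakk> \<Longrightarrow> step x j = h" and h: "real (M + 2) * h \<le> 1 / 4"
    and wU: "\<And>i. i \<le> N \<Longrightarrow> w i \<in> {U_lo..U_hi}" and uU: "\<And>i. i \<le> N \<Longrightarrow> u i \<in> {U_lo..U_hi}"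
    and bd: "w 0 = u 0" "w N = u N"
  shows "norm_H n N x (\<lambda>i. w i - u i) \<le> 8 / b_lo *
    (\<Sum>i=1..N-1. \<bar>chi n N x i * (T_op b U_hi \<epsilon> n N x w i - T_op b U_hi \<epsilon> n N x u i)\<bar>)"
proof -
  have bhl: "b_lo \<le> b_hi" using bnd[OF wU[of 0]] by simp
  define F where "F = flux_x b U_hi 0"
  define z where "z i = w i - u i" for i
  have "\<forall>i. \<exists>\<beta>. b_lo \<le> \<beta> \<and> \<beta> \<le> b_hi \<and> (i \<le> N \<longrightarrow> F (w i) - F (u i) = \<beta> * z i)"
  proof
    fix i
    show "\<exists>\<beta>. b_lo \<le> \<beta> \<and> \<beta> \<le> b_hi \<and> (i \<le> N \<longrightarrow> F (w i) - F (u i) = \<beta> * z i)"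
      using flux_x_difference_quotient[OF cont bnd, of "w i" "u i" 0] wU[of i] uU[of i] bhl
      unfolding F_def z_def by (cases "i \<le> N") auto
  qed
  then obtain \<beta> where slopes: "\<And>i. b_lo \<le> \<beta> i \<and> \<beta> i \<le> b_hi"
    "\<And>i. i \<le> N \<Longrightarrow> F (w i) - F (u i) = \<beta> i * z i" by metis
  interpret hybrid_scheme b_lo b_hi "\<epsilon>\<^sup>2" N n x \<beta>
  proof
    show "b_hi * x (i - 1) * step x i \<le> 2 * \<epsilon>\<^sup>2" if "1 \<le> i" "i \<le> n" for i
      using ratio[OF that] \<epsilon> by (simp add: mesh_ratio_def field_simps)
  qed (use b_lo \<epsilon> NM n x0 step_pos slopes(1) in auto)
  have rw: "row z i = chi n N x i * (T_op b U_hi \<epsilon> n N x w i - T_op b U_hi \<epsilon> n N x u i)"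
    if i: "i \<in> {1..N-1}" for i
  proof -
    have i': "1 \<le> i" "i \<le> N - 1" "i \<le> N" "i + 1 \<le> N" "i - 1 \<le> N" using i NM by auto
    have "0 < step x i" "0 < step x (i + 1)" using step_pos i' by auto
    then have nz: "chi n N x i \<noteq> 0" "step x (i + 1) \<noteq> 0" "avg_step x i \<noteq> 0"
      using chi_pos[OF i'(1,2)] by (auto simp: avg_step_def)
    have Fw: "F (w j) = F (u j) + \<beta> j * z j" if "j \<le> N" for j using slopes(2)[OF that] by simp
    have W: "w j = u j + z j" for j by (simp add: z_def)
    show ?thesis
      unfolding right_diff_distrib chi_T_op[OF nz] F_def[symmetric]
        Fw[OF i'(3)] Fw[OF i'(4)] Fw[OF i'(5)]
      unfolding W[of i] W[of "i + 1"] W[of "i - 1"] diag_def lower_def upper_def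
      by (simp add: algebra_simps add_divide_distrib diff_divide_distrib i'(1))
  qed
  have z0: "z 0 = 0" "z N = 0" using bd by (auto simp: z_def)
  have "b_lo / 4 * norm_H n N x z \<le> 2 * (\<Sum>i=1..N-1. \<bar>row z i\<bar>)"
  proof (cases "0 \<le> lower N")
    case True
    have "0 \<le> norm_H n N x z" unfolding norm_H_def
      by (intro sum_nonneg mult_nonneg_nonneg less_imp_le[OF chi_pos]) auto
    then have "0 \<le> b_lo / 2 * norm_H n N x z" using b_lo by simp
    then show ?thesis using stability_dominant[OF z0 True] by simp
  next
    case False
    then show ?thesis
      using stability_not_dominant[OF z0 _ _ NM unif xN h] M by auto
  qed
  then have "norm_H n N x z \<le> 8 / b_lo * (\<Sum>i=1..N-1. \<bar>row z i\<bar>)"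
    using b_lo by (simp add: field_simps)
  also have "(\<Sum>i=1..N-1. \<bar>row z i\<bar>)
      = (\<Sum>i=1..N-1. \<bar>chi n N x i * (T_op b U_hi \<epsilon> n N x w i - T_op b U_hi \<epsilon> n N x u i)\<bar>)"
    using rw by (intro sum.cong) auto
  finally show "norm_H n N x (\<lambda>i. w i - u i) \<le> 8 / b_lo *
     (\<Sum>i=1..N-1. \<bar>chi n N x i * (T_op b U_hi \<epsilon> n N x w i - T_op b U_hi \<epsilon> n N x u i)\<bar>)"
    by (simp add: z_def[abs_def])
qed

section \<open>Iterated logarithms and the geometry of the mesh\<close>

lemma iter_ln_0: "iter_ln 0 y = y"
  by (simp add: iter_ln_def)

lemma iter_ln_Suc: "iter_ln (Suc k) y = ln (iter_ln k y)"
  by (simp add: iter_ln_def)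

lemma filterlim_iter_ln: "filterlim (iter_ln k) at_top at_top"
proof (induction k)
  case 0
  then show ?case by (simp add: iter_ln_def filterlim_ident id_def)
next
  case (Suc k)
  then show ?case
    using filterlim_compose[OF ln_at_top Suc] by (simp add: iter_ln_Suc[abs_def])
qed

text \<open>With \<open>j\<close> starting at 1, an index at which two pieces meet is assigned to
  the left piece, as its last point. This matches the numbering of steps, since
  \<open>step x i\<close> ends at \<open>x i\<close>.\<close>

lemma block_index:
  fixes Ns :: "nat \<Rightarrow> nat"
  assumes "1 \<le> i" "i \<le> (\<Sum>m=1..<Suc K. Ns m)"
  shows "\<exists>k\<in>{1..K}. \<exists>j\<in>{1..Ns k}. i = (\<Sum>m=1..<k. Ns m) + j"
  using assms
proof (induction K)
  case (Suc K)
  show ?case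
  proof (cases "i \<le> (\<Sum>m=1..<Suc K. Ns m)")
    case True
    then obtain k j where "k \<in> {1..K}" "j \<in> {1..Ns k}" "i = (\<Sum>m=1..<k. Ns m) + j"
      using Suc.IH Suc.prems(1) by blast
    then show ?thesis by (intro bexI[of _ k] bexI[of _ j]) auto
  next
    case False
    let ?j = "i - (\<Sum>m=1..<Suc K. Ns m)"
    have "?j \<in> {1..Ns (Suc K)}" "i = (\<Sum>m=1..<Suc K. Ns m) + ?j" using False Suc.prems by auto
    then show ?thesis by (intro bexI[of _ "Suc K"] bexI[of _ ?j]) auto
  qed
qed simp

locale S_mesh_blocks =
  fixes \<alpha> c \<epsilon> :: real and l N :: nat and x :: "nat \<Rightarrow> real" and Ns :: "nat \<Rightarrow> nat"
  assumes \<alpha>: "0 < \<alpha>" and c: "1 \<le> c" and \<epsilon>: "0 < \<epsilon>" and l: "1 \<le> l"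
    and logs: "\<And>j. j \<le> l \<Longrightarrow> 0 < iter_ln j (real N)"
    and last_transition: "transition_point \<alpha> l \<epsilon> (real N) l < 1"
    and Ns: "\<And>k. \<lbrakk>1 \<le> k; k \<le> l + 1\<rbrakk> \<Longrightarrow> 2 \<le> Ns k \<and> real N \<le> c * real (Ns k)"
    and Ns_sum: "(\<Sum>k=1..l+1. Ns k) = N"
    and points: "\<And>k j. \<lbrakk>1 \<le> k; k \<le> l + 1; j \<le> Ns k\<rbrakk> \<Longrightarrow>
      x ((\<Sum>m=1..<k. Ns m) + j) = transition_point \<alpha> l \<epsilon> (real N) (k - 1) +
        real j * (transition_point \<alpha> l \<epsilon> (real N) k - transition_point \<alpha> l \<epsilon> (real N) (k - 1))
          / real (Ns k)"
    and step_mono1: "\<And>i. \<lbrakk>1 \<le> i; i \<le> N - 1\<rbrakk> \<Longrightarrow> step x i \<le> step x (i + 1)"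

lemma S_mesh_imp_blocks:
  assumes "S_mesh \<alpha> l c \<epsilon> N x" "0 < \<alpha>" "1 \<le> c" "0 < \<epsilon>"
  obtains Ns where "S_mesh_blocks \<alpha> c \<epsilon> l N x Ns"
proof -
  obtain K Ns where K: "iter_ln_depth (real N) K" "1 \<le> l" "l \<le> K"
    and rest: "transition_point \<alpha> l \<epsilon> (real N) l < 1"
      "\<forall>k\<in>{1..l+1}. 2 \<le> Ns k \<and> real N \<le> c * real (Ns k)" "(\<Sum>k=1..l+1. Ns k) = N"
      "\<forall>k\<in>{1..l+1}. \<forall>j\<le>Ns k. x ((\<Sum>m=1..<k. Ns m) + j) =
        transition_point \<alpha> l \<epsilon> (real N) (k - 1) +
        real j * (transition_point \<alpha> l \<epsilon> (real N) k - transition_point \<alpha> l \<epsilon> (real N) (k - 1))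
          / real (Ns k)"
      "\<forall>i\<in>{1..N-1}. step x i \<le> step x (i + 1)"
    using assms(1) unfolding S_mesh_def by blast
  have "0 < iter_ln j (real N)" if "j \<le> l" for j
  proof (cases "j < K")
    case True
    then show ?thesis using K unfolding iter_ln_depth_def by auto
  next
    case False
    then have "j = K" using that K(3) by linarith
    then show ?thesis using K unfolding iter_ln_depth_def by auto
  qed
  then show ?thesis
    using that[of Ns] K rest assms(2-) unfolding S_mesh_blocks_def by auto
qed

context S_mesh_blocks
begin

definition start :: "nat \<Rightarrow> nat" where "start k = (\<Sum>m=1..<k. Ns m)"

abbreviation T :: "nat \<Rightarrow> real" where "T \<equiv> transition_point \<alpha> l \<epsilon> (real N)"

lemma start_Suc: "1 \<le> k \<Longrightarrow> start (Suc k) = start k + Ns k"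
  by (simp add: start_def sum.atLeastLessThan_Suc)

lemma start_1: "start 1 = 0"
  by (simp add: start_def)

lemma start_end: "start (l + 2) = N"
  using Ns_sum by (simp add: start_def atLeastLessThanSuc_atLeastAtMost)

lemma block_points: "\<lbrakk>1 \<le> k; k \<le> l + 1; j \<le> Ns k\<rbrakk> \<Longrightarrow>
    x (start k + j) = T (k - 1) + real j * (T k - T (k - 1)) / real (Ns k)"
  using points unfolding start_def by blast

lemma start_last: "start (l + 1) + Ns (l + 1) = N"
  using start_end start_Suc[of "l + 1"] by simp

lemma N_ge: "4 \<le> N"
proof -
  have "start 2 = Ns 1" using start_Suc[of 1] start_1 by (simp add: numeral_2_eq_2)
  moreover have "start 2 \<le> start (l + 1)" unfolding start_def using l by (intro sum_mono2) auto
  ultimately show ?thesis using Ns[of 1] Ns[of "l + 1"] l start_last by simp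
qed

lemma T_0: "T 0 = 0" and T_last: "T (l + 1) = 1"
  by (simp_all add: transition_point_def)

lemma T_eq: "\<lbrakk>1 \<le> k; k \<le> l\<rbrakk> \<Longrightarrow> T k = \<alpha> * \<epsilon> * iter_ln (l - k + 1) (real N)"
  by (simp add: transition_point_def)

lemma T_first: "T 1 = \<alpha> * \<epsilon> * iter_ln l (real N)"
  using T_eq[of 1] l by simp

lemma T_l: "T l = \<alpha> * \<epsilon> * ln (real N)"
  using T_eq[of l] l by (simp add: iter_ln_Suc iter_ln_0)

lemma T_pos: "1 \<le> k \<Longrightarrow> k \<le> l + 1 \<Longrightarrow> 0 < T k"
  using T_eq[of k] T_last logs[of "l - k + 1"] \<alpha> \<epsilon> by (cases "k = l + 1") auto

lemma T_Suc_exp: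
  assumes "1 \<le> k" "k < l"
  shows "T (Suc k) = \<alpha> * \<epsilon> * exp (T k / (\<alpha> * \<epsilon>))"
proof -
  have "l - k + 1 = Suc (l - Suc k + 1)" using assms by simp
  then have "T k = \<alpha> * \<epsilon> * ln (iter_ln (l - Suc k + 1) (real N))"
    using T_eq[of k] assms iter_ln_Suc by simp
  then show ?thesis using T_eq[of "Suc k"] assms logs[of "l - Suc k + 1"] \<alpha> \<epsilon> by simp
qed

lemma T_le_Suc: "k \<le> l \<Longrightarrow> T k \<le> T (Suc k)"
proof -
  assume k: "k \<le> l"
  consider "k = 0" | "k = l" | "1 \<le> k" "k < l" using k by linarith
  then show ?thesis
  proof cases
    case 3
    have "T k / (\<alpha> * \<epsilon>) \<le> exp (T k / (\<alpha> * \<epsilon>))"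
      using exp_ge_add_one_self[of "T k / (\<alpha> * \<epsilon>)"] by linarith
    then show ?thesis using T_Suc_exp[OF 3] \<alpha> \<epsilon> by (simp add: field_simps)
  qed (use T_0 T_last T_pos[of 1] last_transition in auto)
qed

lemma T_nonneg: "k \<le> l + 1 \<Longrightarrow> 0 \<le> T k"
  using T_pos[of k] T_0 by (cases "k = 0") (auto intro: less_imp_le)

lemma point_end:
  assumes "1 \<le> k" "k \<le> l + 1"
  shows "x (start k + Ns k) = T k"
proof -
  have "real (Ns k) \<noteq> 0" using Ns[OF assms] by simp
  then show ?thesis unfolding block_points[OF assms order_refl] by simp
qed

lemma x_0: "x 0 = 0"
proof -
  have "x (start 1 + 0) = T (1 - 1) + real 0 * (T 1 - T (1 - 1)) / real (Ns 1)"
    by (rule block_points) simp_all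
  then show ?thesis by (simp add: start_1[simplified] T_0)
qed

lemma x_N: "x N = 1"
proof -
  have "x (start (l + 1) + Ns (l + 1)) = T (l + 1)" by (rule point_end) simp_all
  then show ?thesis unfolding start_last T_last .
qed

lemma step_block:
  assumes k: "1 \<le> k" "k \<le> l + 1" and j: "1 \<le> j" "j \<le> Ns k"
  shows "step x (start k + j) = (T k - T (k - 1)) / real (Ns k)"
proof -
  have "start k + j - 1 = start k + (j - 1)" using j by simp
  then have "step x (start k + j) = x (start k + j) - x (start k + (j - 1))"
    by (simp add: step_def)
  also have "\<dots> = (real j - real (j - 1)) * (T k - T (k - 1)) / real (Ns k)"
  proof -
    have "j - 1 \<le> Ns k" using j by simp
    then show ?thesis unfolding block_points[OF k j(2)] block_points[OF k \<open>j - 1 \<le> Ns k\<close>]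
      by (simp add: left_diff_distrib diff_divide_distrib)
  qed
  also have "real j - real (j - 1) = 1" using j by simp
  finally show ?thesis by simp
qed

lemma step_block_le:
  assumes k: "1 \<le> k" "k \<le> l + 1" and j: "1 \<le> j" "j \<le> Ns k"
  shows "step x (start k + j) \<le> c * T k / real N"
proof -
  have pos: "0 < real (Ns k)" "0 < real N" using Ns[OF k] N_ge by auto
  have "(T k - T (k - 1)) / real (Ns k) \<le> T k / real (Ns k)"
    using T_nonneg[of "k - 1"] k pos by (intro divide_right_mono) auto
  also have "T k * real N \<le> T k * (c * real (Ns k))"
    using Ns[OF k] T_nonneg[of k] k by (intro mult_left_mono) auto
  then have "T k / real (Ns k) \<le> c * T k / real N" using pos by (simp add: field_simps)
  finally show ?thesis using step_block[OF assms] by simp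
qed

lemma step_mono: "\<lbrakk>1 \<le> i; i \<le> j; j \<le> N\<rbrakk> \<Longrightarrow> step x i \<le> step x j"
proof (induction j)
  case (Suc j)
  show ?case
  proof (cases "i = Suc j")
    case False
    then have "step x i \<le> step x j" "step x j \<le> step x (j + 1)"
      using Suc step_mono1[of j] by auto
    then show ?thesis by simp
  qed simp
qed simp

lemma step_pos: "\<lbrakk>1 \<le> i; i \<le> N\<rbrakk> \<Longrightarrow> 0 < step x i"
proof -
  assume i: "1 \<le> i" "i \<le> N"
  have "0 < step x 1" using step_block[of 1 1] T_pos[of 1] T_0 Ns[of 1] l start_1 by simp
  then show ?thesis using step_mono[of 1 i] i by simp
qed

lemma x_mono: "\<lbrakk>i \<le> j; j \<le> N\<rbrakk> \<Longrightarrow> x i \<le> x j"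
proof (induction j)
  case (Suc j)
  then show ?case using step_pos[of "Suc j"] by (cases "i = Suc j") (auto simp: step_def)
qed simp

text \<open>Both \<open>x (i - 1)\<close> and \<open>step x i\<close> are nondecreasing in
  \<open>i\<close>, hence so is the mesh ratio, and the admissible indices form an initial segment.
  Index 1 always belongs to it because \<open>x 0 = 0\<close>.\<close>

lemma switch_index_facts:
  fixes b_hi :: real
  assumes "0 \<le> b_hi"
  defines "n \<equiv> switch_index b_hi \<epsilon> N x"
  shows "1 \<le> n" "n \<le> N - 1"
    and "\<And>i. \<lbrakk>1 \<le> i; i \<le> n\<rbrakk> \<Longrightarrow> mesh_ratio b_hi \<epsilon> x i \<le> 1"
    and "\<And>i. \<lbrakk>1 \<le> i; i \<le> N - 1; mesh_ratio b_hi \<epsilon> x i \<le> 1\<rbrakk> \<Longrightarrow> i \<le> n"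
proof -
  let ?S = "{i \<in> {1..N-1}. mesh_ratio b_hi \<epsilon> x i \<le> 1}"
  have "1 \<in> ?S" using N_ge x_0 by (simp add: mesh_ratio_def)
  then have "n \<in> ?S" unfolding n_def switch_index_def by (intro Max_in) auto
  then show n: "1 \<le> n" "n \<le> N - 1" by auto
  show "i \<le> n" if "1 \<le> i" "i \<le> N - 1" "mesh_ratio b_hi \<epsilon> x i \<le> 1" for i
    unfolding n_def switch_index_def using that by (intro Max_ge) auto
  show "mesh_ratio b_hi \<epsilon> x i \<le> 1" if i: "1 \<le> i" "i \<le> n" for i
  proof -
    have "x (i - 1) * step x i \<le> x (n - 1) * step x n"
      using i n x_mono[of "i - 1" "n - 1"] x_mono[of 0 "n - 1"] step_mono[of i n] step_pos[of i] x_0 N_ge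
      by (intro mult_mono less_imp_le[OF step_pos]) auto
    then have "b_hi * (x (i - 1) * step x i) \<le> b_hi * (x (n - 1) * step x n)"
      using assms(1) by (rule mult_left_mono)
    then have "mesh_ratio b_hi \<epsilon> x i \<le> mesh_ratio b_hi \<epsilon> x n"
      unfolding mesh_ratio_def by (intro divide_right_mono) (auto simp: mult.assoc)
    then show ?thesis using \<open>n \<in> ?S\<close> by simp
  qed
qed

text \<open>Index of the outermost transition point \<open>T l\<close>.\<close>

definition layer_end :: nat where "layer_end = start (l + 1)"

lemma layer_end_eq: "layer_end = start l + Ns l"
  using start_Suc[of l] l by (simp add: layer_end_def)

lemma x_layer_end: "x layer_end = \<alpha> * \<epsilon> * ln (real N)"
  using point_end[of l] l T_l layer_end_eq by simp

lemma layer_end_bounds: "2 \<le> layer_end" "layer_end + 2 \<le> N"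
proof -
  show "2 \<le> layer_end" unfolding layer_end_eq using Ns[of l] l by simp
  show "layer_end + 2 \<le> N" using start_last Ns[of "l + 1"] unfolding layer_end_def by simp
qed

text \<open>At least two subintervals per piece put the last but one point in the right half of its
  piece. The stencil of a row at a transition point reaches back to this point; the factor 2 here is
  the one in the exponent of \<open>layer_steps\<close>.\<close>

lemma point_before_end:
  assumes k: "1 \<le> k" "k \<le> l"
  shows "T k \<le> 2 * x (start k + Ns k - 1)"
proof -
  have N2: "2 \<le> Ns k" using Ns[of k] k by simp
  then have "start k + Ns k - 1 = start k + (Ns k - 1)" by simp
  then have "x (start k + Ns k - 1) = T (k - 1) + real (Ns k - 1) * (T k - T (k - 1)) / real (Ns k)"
    using block_points[of k "Ns k - 1"] k by simp
  also have "\<dots> \<ge> T (k - 1) + (T k - T (k - 1)) / 2"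
  proof -
    have "1 / 2 \<le> real (Ns k - 1) / real (Ns k)" using N2 by (simp add: field_simps of_nat_diff)
    moreover have "0 \<le> T k - T (k - 1)" using T_le_Suc[of "k - 1"] k by simp
    ultimately have "1 / 2 * (T k - T (k - 1)) \<le> real (Ns k - 1) / real (Ns k) * (T k - T (k - 1))"
      by (rule mult_right_mono)
    then show ?thesis by simp
  qed
  finally have X: "T (k - 1) + (T k - T (k - 1)) / 2 \<le> x (start k + Ns k - 1)" .
  have half: "t \<le> 2 * y" if "s + (t - s) / 2 \<le> y" "0 \<le> s" for s t y :: real
    using that by (simp add: field_simps)
  have "0 \<le> T (k - 1)" using T_nonneg k by simp
  then show ?thesis by (rule half[OF X])
qed

lemma x_before_layer_end: "\<alpha> * \<epsilon> * ln (real N) / 2 \<le> x (layer_end - 1)"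
  using point_before_end[of l] l T_l layer_end_eq by simp

lemma step_layer_le:
  assumes "1 \<le> i" "i \<le> layer_end"
  shows "step x i \<le> c * (\<alpha> * \<epsilon> * ln (real N)) / real N"
proof -
  have "layer_end \<le> N" using layer_end_bounds by simp
  then have "step x i \<le> step x layer_end" using assms by (rule step_mono[rotated 2])
  also have "\<dots> \<le> c * T l / real N"
    unfolding layer_end_eq using step_block_le[of l "Ns l"] Ns[of l] l by simp
  finally show ?thesis using T_l by simp
qed

lemma step_tail:
  assumes "layer_end < j" "j \<le> N"
  shows "step x j = step x N" and "step x j \<le> c / real N"
proof -
  define i where "i = j - layer_end"
  have i: "1 \<le> i" "i \<le> Ns (l + 1)" "start (l + 1) + i = j"
    using assms start_last by (auto simp: i_def layer_end_def)
  have "step x j = (T (l + 1) - T l) / real (Ns (l + 1))"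
    using step_block[OF _ _ i(1,2)] unfolding i(3) by simp
  moreover have "step x N = (T (l + 1) - T l) / real (Ns (l + 1))"
    using step_block[of "l + 1" "Ns (l + 1)"] Ns[of "l + 1"] unfolding start_last by simp
  ultimately show "step x j = step x N" by simp
  show "step x j \<le> c / real N" using step_block_le[OF _ _ i(1,2)] unfolding i(3) T_last by simp
qed

lemma tail_length: "real N \<le> c * (real N - real layer_end)"
proof -
  have "real N = real layer_end + real (Ns (l + 1))"
    using start_last unfolding layer_end_def by (metis of_nat_add)
  then show ?thesis using Ns[of "l + 1"] by simp
qed

text \<open>The indices of the inner transition points \<open>T k\<close> with \<open>k < l\<close>.
  The outermost one is left out because its row is treated together with the tail.\<close>

definition junctions :: "nat set" where
  "junctions = (\<lambda>k. start (Suc k)) ` {1..<l}"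

lemma card_junctions: "finite junctions" "card junctions \<le> l"
proof -
  show "finite junctions" by (simp add: junctions_def)
  have "card junctions \<le> card {1..<l}" unfolding junctions_def by (rule card_image_le) simp
  then show "card junctions \<le> l" by simp
qed

text \<open>If the step after \<open>x i\<close> lies in piece \<open>m\<close>, it is at most
  \<open>c * T m / real N\<close>. For \<open>m = 1\<close> this already has the required form.
  Otherwise \<open>T m\<close> is an exponential of \<open>T (m - 1)\<close>, which is at most
  \<open>2 * x (i - 1)\<close>, and the iterated logarithm, being at least 1, can be inserted as a
  factor.\<close>

lemma layer_steps:
  assumes i: "1 \<le> i" "i < layer_end" and L: "1 \<le> iter_ln l (real N)"
  shows "step x (i + 1) \<le>
      \<epsilon> * (c * \<alpha> * iter_ln l (real N) / real N) * exp (2 * x (i - 1) / (\<alpha> * \<epsilon>))"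
    and "i \<notin> junctions \<Longrightarrow> step x i = step x (i + 1)"
proof -
  obtain k j where k: "1 \<le> k" "k \<le> l" and j: "1 \<le> j" "j \<le> Ns k" and ij: "i = start k + j"
    using block_index[where i=i and K=l and Ns=Ns] i
    unfolding layer_end_def start_def by auto
  have x_prev: "0 \<le> x (i - 1)" using x_mono[of 0 "i - 1"] x_0 i layer_end_bounds by simp
  have bound: "c * T m / real N \<le>
      \<epsilon> * (c * \<alpha> * iter_ln l (real N) / real N) * exp (2 * x (i - 1) / (\<alpha> * \<epsilon>))"
    if m: "1 \<le> m" "m \<le> l" and prev: "2 \<le> m \<Longrightarrow> T (m - 1) \<le> 2 * x (i - 1)" for m
  proof -
    have ex: "1 \<le> exp (2 * x (i - 1) / (\<alpha> * \<epsilon>))" using x_prev \<alpha> \<epsilon> by simp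
    have "T m \<le> \<alpha> * \<epsilon> * (iter_ln l (real N) * exp (2 * x (i - 1) / (\<alpha> * \<epsilon>)))"
    proof (cases "m = 1")
      case True
      have "iter_ln l (real N) * 1 \<le> iter_ln l (real N) * exp (2 * x (i - 1) / (\<alpha> * \<epsilon>))"
        using ex L by (intro mult_left_mono) auto
      then show ?thesis using True T_first \<alpha> \<epsilon> by simp
    next
      case False
      then have m': "1 \<le> m - 1" "m - 1 < l" "Suc (m - 1) = m" "2 \<le> m" using m by auto
      have "exp (T (m - 1) / (\<alpha> * \<epsilon>)) \<le> exp (2 * x (i - 1) / (\<alpha> * \<epsilon>))"
        using prev[OF m'(4)] \<alpha> \<epsilon> by (simp add: divide_right_mono)
      also have "\<dots> \<le> iter_ln l (real N) * exp (2 * x (i - 1) / (\<alpha> * \<epsilon>))"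
        using mult_right_mono[OF L, of "exp (2 * x (i - 1) / (\<alpha> * \<epsilon>))"] by simp
      finally show ?thesis using T_Suc_exp[OF m'(1,2)] m'(3) \<alpha> \<epsilon> by simp
    qed
    then have "c / real N * T m
        \<le> c / real N * (\<alpha> * \<epsilon> * (iter_ln l (real N) * exp (2 * x (i - 1) / (\<alpha> * \<epsilon>))))"
      using c by (intro mult_left_mono) auto
    then show ?thesis by (simp add: mult_ac)
  qed
  show "step x (i + 1) \<le>
      \<epsilon> * (c * \<alpha> * iter_ln l (real N) / real N) * exp (2 * x (i - 1) / (\<alpha> * \<epsilon>))"
  proof (cases "j < Ns k")
    case True
    have "T (k - 1) \<le> x (i - 1)"
    proof -
      have "i - 1 = start k + (j - 1)" using ij j by simp
      then have "x (i - 1) = T (k - 1) + real (j - 1) * (T k - T (k - 1)) / real (Ns k)"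
        using block_points[of k "j - 1"] k j by simp
      moreover have "0 \<le> T k - T (k - 1)" using T_le_Suc[of "k - 1"] k by simp
      ultimately show ?thesis by simp
    qed
    moreover have "step x (i + 1) \<le> c * T k / real N"
      using step_block_le[of k "j + 1"] k True ij by simp
    ultimately show ?thesis using bound[OF k] x_prev by force
  next
    \<comment> \<open>Here \<open>x i\<close> is the end of piece \<open>k\<close>, and the next
      step belongs to piece \<open>k + 1\<close>; \<open>x (i - 1)\<close> lies before
      \<open>T k\<close> but not below half of it.\<close>
    case False
    then have jk: "j = Ns k" using j by simp
    have kl: "k < l" using i ij jk k layer_end_eq by (cases "k = l") auto
    have "i + 1 = start (Suc k) + 1" using ij jk start_Suc[OF k(1)] by simp
    then have "step x (i + 1) \<le> c * T (Suc k) / real N"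
      using step_block_le[of "Suc k" 1] kl Ns[of "Suc k"] by simp
    moreover have "T k \<le> 2 * x (i - 1)" using point_before_end[OF k] ij jk by simp
    ultimately show ?thesis using bound[of "Suc k"] kl by force
  qed
  show "step x i = step x (i + 1)" if "i \<notin> junctions"
  proof (cases "j < Ns k")
    case True
    then show ?thesis using step_block[of k j] step_block[of k "j + 1"] k j ij by simp
  next
    case False
    then have jk: "j = Ns k" using j by simp
    have kl: "k < l" using i ij jk k layer_end_eq by (cases "k = l") auto
    have "i = start (Suc k)" using ij jk start_Suc[OF k(1)] by simp
    then show ?thesis using that kl k by (auto simp: junctions_def)
  qed
qed

end

section \<open>Summing the consistency errors inside and outside the layer\<close>

lemma step_le_exp_diff:
  fixes s r :: real
  assumes "0 \<le> s" "s \<le> 1"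
  shows "s * exp (- r) \<le> 2 * (exp (- r) - exp (- (r + s)))"
proof -
  \<comment> \<open>The two estimates add up to \<open>s \<le> 2 * (1 - exp (- s))\<close>. In this
    way a Riemann sum of the decaying exponential is replaced by a telescoping one.\<close>
  have "(1 + s) * exp (- s) \<le> exp s * exp (- s)"
    using exp_ge_add_one_self[of s] by (intro mult_right_mono) auto
  then have "(1 + s) * exp (- s) \<le> 1" by (simp add: exp_minus)
  moreover have "0 \<le> (1 - s) * (1 - exp (- s))" using assms by (intro mult_nonneg_nonneg) auto
  ultimately have "s \<le> 2 * (1 - exp (- s))" by (simp add: algebra_simps)
  then have "exp (- r) * s \<le> exp (- r) * (2 * (1 - exp (- s)))" by (intro mult_left_mono) auto
  then show ?thesis by (simp add: exp_add[symmetric] algebra_simps)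
qed

text \<open>The single factor \<epsilon> produced by this rescaling is the one that appears in the
  final bound.\<close>

lemma chi_T_op_central:
  fixes b :: "real \<Rightarrow> real" and u :: "real \<Rightarrow> real"
  assumes cen: "central_row n N i" and "0 < \<epsilon>" "0 < step x i" "0 < step x (i + 1)"
  shows "chi n N x i * T_op b U_hi \<epsilon> n N x (\<lambda>i. u (x i)) i =
    \<epsilon> * central_residual (flux_x b U_hi 0) (\<lambda>t. u (\<epsilon> * t))
          (x i / \<epsilon>) (step x i / \<epsilon>) (step x (i + 1) / \<epsilon>)"
proof -
  define F where "F = flux_x b U_hi 0"
  have chi: "chi n N x i = avg_step x i" using cen by (auto simp: chi_def central_row_def)
  have nz: "chi n N x i \<noteq> 0" "step x (i + 1) \<noteq> 0" "avg_step x i \<noteq> 0"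
    using assms unfolding chi by (auto simp: avg_step_def)
  have q: "x i / \<epsilon> - step x i / \<epsilon> = x (i - 1) / \<epsilon>" "x i / \<epsilon> + step x (i + 1) / \<epsilon> = x (i + 1) / \<epsilon>"
    by (simp_all add: step_def diff_divide_distrib)
  have pts: "\<epsilon> * (x j / \<epsilon>) = x j" for j
    using assms(2) by simp
  show ?thesis
    unfolding chi_T_op[OF nz] central_residual_def F_def[symmetric] q pts
    using cen assms(2-)
    by (simp add: flux_next_def flux_here_def flux_prev_def source_here_def source_next_def chi
        avg_step_def power2_eq_square field_simps)
qed

context S_mesh_blocks
begin

text \<open>The rate \<open>4 / \<alpha> + 1\<close> is chosen so that \<open>4 / \<alpha>\<close>
  cancels the growth of the squared step and one unit of decay is left for the summation. In the
  result, 2 stems from the telescoping sum and \<open>2 * real l\<close> from the junction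
  rows.\<close>

lemma layer_consistency:
  fixes b u :: "real \<Rightarrow> real" and K m :: real
  defines "\<kappa> \<equiv> c * \<alpha> * iter_ln l (real N) / real N"
  assumes prof: "layer_profile (flux_x b U_hi 0) U_hi (4 / \<alpha> + 1) m K (1 / \<epsilon>) (\<lambda>t. u (\<epsilon> * t))"
    and K: "0 \<le> K" and L: "1 \<le> iter_ln l (real N)" and fine: "c * \<alpha> * ln (real N) / real N \<le> 1"
    and n: "layer_end \<le> n" "n \<le> N - 1"
  shows "(\<Sum>i=1..<layer_end. \<bar>chi n N x i * T_op b U_hi \<epsilon> n N x (\<lambda>i. u (x i)) i\<bar>)
    \<le> \<epsilon> * (K * \<kappa>\<^sup>2 * (2 + 2 * real l))"
proof -
  define F where "F = flux_x b U_hi 0"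
  define v where "v = (\<lambda>t. u (\<epsilon> * t))"
  define e where "e i = exp (- (x i / \<epsilon>))" for i
  have row: "\<bar>chi n N x i * T_op b U_hi \<epsilon> n N x (\<lambda>i. u (x i)) i\<bar>
      \<le> \<epsilon> * (K * \<kappa>\<^sup>2 * (2 * (e (i - 1) - e i) + (if i \<in> junctions then 2 else 0)))"
    if i: "i \<in> {1..<layer_end}" for i
  proof -
    define s s' r where "s = step x i / \<epsilon>" and "s' = step x (i + 1) / \<epsilon>" and "r = x (i - 1) / \<epsilon>"
    have iN: "1 \<le> i" "i \<le> N" "i + 1 \<le> N" "i \<le> N - 1" using i layer_end_bounds by auto
    have hp: "0 < step x i" "0 < step x (i + 1)" using step_pos iN by auto
    have s: "0 < s" "s \<le> s'" using hp \<epsilon> step_mono1[OF iN(1,4)]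
      by (auto simp: s_def s'_def divide_right_mono)
    have ts: "x i / \<epsilon> - s = r" "x i / \<epsilon> + s' = x (i + 1) / \<epsilon>"
      by (simp_all add: s_def s'_def r_def step_def diff_divide_distrib)
    have r: "0 \<le> r" using x_mono[of 0 "i - 1"] x_0 iN \<epsilon> by (simp add: r_def)
    have R: "x i / \<epsilon> + s' \<le> 1 / \<epsilon>"
      unfolding ts using x_mono[of "i + 1" N] x_N iN \<epsilon> by (simp add: divide_right_mono)
    have cen: "central_row n N i"
      using i n layer_end_bounds by (auto simp: central_row_def)
    have eq: "\<bar>chi n N x i * T_op b U_hi \<epsilon> n N x (\<lambda>i. u (x i)) i\<bar>
        = \<epsilon> * \<bar>central_residual F v (x i / \<epsilon>) s s'\<bar>"
      unfolding chi_T_op_central[OF cen \<epsilon> hp] s_def s'_def F_def v_def using \<epsilon>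
      by (simp add: abs_mult)
    have A: "0 \<le> 4 / \<alpha> + 1" using \<alpha> by simp
    note bounds = central_residual_bounds[OF prof[folded F_def v_def] A s, of "x i / \<epsilon>", unfolded ts(1), OF r R]
    have arg: "2 * x (i - 1) / (\<alpha> * \<epsilon>) = 2 * r / \<alpha>" by (simp add: r_def)
    have s'le: "s' \<le> \<kappa> * exp (2 * r / \<alpha>)"
    proof -
      have "step x (i + 1) \<le> \<epsilon> * \<kappa> * exp (2 * r / \<alpha>)"
        using layer_steps(1)[of i] i L unfolding \<kappa>_def arg by simp
      then show ?thesis using \<epsilon> by (simp add: s'_def pos_divide_le_eq mult_ac)
    qed
    have s'sq: "s'\<^sup>2 \<le> \<kappa>\<^sup>2 * exp (4 * r / \<alpha>)"
    proof -
      have "s'\<^sup>2 \<le> (\<kappa> * exp (2 * r / \<alpha>))\<^sup>2" using s'le s by (intro power_mono) auto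
      also have "\<dots> = \<kappa>\<^sup>2 * exp (4 * r / \<alpha>)"
        by (simp add: power_mult_distrib power2_eq_square exp_add[symmetric])
      finally show ?thesis .
    qed
    have damp: "s'\<^sup>2 * exp (- ((4 / \<alpha> + 1) * r)) \<le> \<kappa>\<^sup>2 * exp (- r)"
    proof -
      have "s'\<^sup>2 * exp (- ((4 / \<alpha> + 1) * r)) \<le> \<kappa>\<^sup>2 * exp (4 * r / \<alpha>) * exp (- ((4 / \<alpha> + 1) * r))"
        using s'sq by (intro mult_right_mono) auto
      also have "\<dots> = \<kappa>\<^sup>2 * exp (- r)" by (simp add: mult.assoc exp_add[symmetric] algebra_simps)
      finally show ?thesis .
    qed
    have s1: "s \<le> 1"
    proof -
      have "step x i \<le> \<epsilon> * (c * \<alpha> * ln (real N) / real N)"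
        using step_layer_le[of i] i by (simp add: mult_ac)
      also have "\<dots> \<le> \<epsilon> * 1" using fine \<epsilon> by (intro mult_left_mono) auto
      finally show ?thesis using \<epsilon> by (simp add: s_def)
    qed
    have e: "e (i - 1) = exp (- r)" "e i = exp (- (r + s))"
      using ts(1) by (simp add: e_def r_def, simp add: e_def algebra_simps)
    have ed: "s * exp (- r) \<le> 2 * (e (i - 1) - e i)"
      unfolding e using step_le_exp_diff[of s r] s s1 by simp
    have "\<bar>central_residual F v (x i / \<epsilon>) s s'\<bar>
        \<le> K * \<kappa>\<^sup>2 * (2 * (e (i - 1) - e i) + (if i \<in> junctions then 2 else 0))"
    proof (cases "i \<in> junctions")
      case True
      have "\<bar>central_residual F v (x i / \<epsilon>) s s'\<bar> \<le> 2 * K * (s'\<^sup>2 * exp (- ((4 / \<alpha> + 1) * r)))"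
        using bounds(1) by (simp add: mult_ac)
      also have "\<dots> \<le> 2 * K * (\<kappa>\<^sup>2 * exp (- r))" using damp K by (intro mult_left_mono) auto
      also have "\<dots> = K * \<kappa>\<^sup>2 * (2 * exp (- r))" by simp
      \<comment> \<open>No factor \<open>s\<close> is available in a junction row, so its
        exponential is simply bounded by 1; the nonnegative difference is added only to give all
        rows the same form.\<close>
      also have "\<dots> \<le> K * \<kappa>\<^sup>2 * (2 * (e (i - 1) - e i) + 2)"
      proof (intro mult_left_mono)
        have "0 \<le> s * exp (- r)" using s by simp
        moreover have "exp (- r) \<le> 1" using r by simp
        ultimately show "2 * exp (- r) \<le> 2 * (e (i - 1) - e i) + 2" using ed by linarith
      qed (use K in auto)
      finally show ?thesis using True by simp
    next
      case False
      then have ss: "s = s'" using layer_steps(2)[of i] i L by (simp add: s_def s'_def)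
      have "\<bar>central_residual F v (x i / \<epsilon>) s s'\<bar> \<le> K * s * (s'\<^sup>2 * exp (- ((4 / \<alpha> + 1) * r)))"
        using bounds(2)[OF ss] ss by (simp add: power2_eq_square power3_eq_cube mult_ac)
      also have "\<dots> \<le> K * s * (\<kappa>\<^sup>2 * exp (- r))" using damp K s by (intro mult_left_mono) auto
      also have "\<dots> = K * \<kappa>\<^sup>2 * (s * exp (- r))" by simp
      also have "\<dots> \<le> K * \<kappa>\<^sup>2 * (2 * (e (i - 1) - e i))" using ed K by (intro mult_left_mono) auto
      finally show ?thesis using False by simp
    qed
    then show ?thesis unfolding eq using \<epsilon> by (intro mult_left_mono) auto
  qed
  have tele: "(\<Sum>i=1..<k. e (i - 1) - e i) = e 0 - e (k - 1)" if "1 \<le> k" for k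
    using that by (induction k rule: dec_induct) auto
  have "(\<Sum>i=1..<layer_end. \<bar>chi n N x i * T_op b U_hi \<epsilon> n N x (\<lambda>i. u (x i)) i\<bar>)
      \<le> (\<Sum>i=1..<layer_end. \<epsilon> * (K * \<kappa>\<^sup>2 * (2 * (e (i - 1) - e i) + (if i \<in> junctions then 2 else 0))))"
    by (intro sum_mono row)
  also have "\<dots> = \<epsilon> * (K * \<kappa>\<^sup>2 * (2 * (\<Sum>i=1..<layer_end. e (i - 1) - e i)
      + (\<Sum>i=1..<layer_end. if i \<in> junctions then 2 else 0)))"
    by (simp only: sum_distrib_left sum.distrib distrib_left)
  also have "\<dots> \<le> \<epsilon> * (K * \<kappa>\<^sup>2 * (2 + 2 * real l))"
  proof (intro mult_left_mono add_mono)
    show "2 * (\<Sum>i=1..<layer_end. e (i - 1) - e i) \<le> 2"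
      using tele[of layer_end] layer_end_bounds x_0 by (simp add: e_def)
    have "(\<Sum>i=1..<layer_end. if i \<in> junctions then 2 else (0::real))
        = 2 * real (card ({1..<layer_end} \<inter> junctions))"
      by (simp add: sum.If_cases)
    also have "\<dots> \<le> 2 * real l"
      using card_mono[of junctions "{1..<layer_end} \<inter> junctions"] card_junctions by simp
    finally show "(\<Sum>i=1..<layer_end. if i \<in> junctions then 2 else (0::real)) \<le> 2 * real l" .
  qed (use K \<epsilon> in auto)
  finally show ?thesis .
qed

text \<open>Whichever scheme the row carries, only its size matters: the difference quotients are
  values of the small slope, and the flux values are small because \<open>u\<close> is close to
  \<open>U_hi\<close>, where the primitive vanishes.\<close>

lemma outer_consistency:
  fixes b u :: "real \<Rightarrow> real" and K m :: real
  assumes prof: "layer_profile (flux_x b U_hi 0) U_hi A m K (1 / \<epsilon>) (\<lambda>t. u (\<epsilon> * t))"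
    and K: "0 \<le> K" and m: "0 \<le> m" and \<epsilon>1: "\<epsilon> \<le> 1"
    and cont: "continuous_on {U_lo..U_hi} b" and b_lo: "0 < b_lo"
    and bnd: "\<And>v. v \<in> {U_lo..U_hi} \<Longrightarrow> b_lo \<le> b v \<and> b v \<le> b_hi"
    and u: "\<And>y. y \<in> {0..1} \<Longrightarrow> u y \<in> {U_lo..U_hi}"
    and i: "layer_end \<le> i" "i \<le> N - 1"
  shows "\<bar>chi n N x i * T_op b U_hi \<epsilon> n N x (\<lambda>i. u (x i)) i\<bar>
    \<le> (2 + 5 * b_hi) * K * exp (- (m * \<alpha>\<^sup>2 / 4 * (ln (real N))\<^sup>2))"
proof -
  define F where "F = flux_x b U_hi 0"
  define E where "E = exp (- (m * \<alpha>\<^sup>2 / 4 * (ln (real N))\<^sup>2))"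
  have iN: "1 \<le> i" "i \<le> N" "i + 1 \<le> N" "i - 1 \<le> N" using i layer_end_bounds by auto
  have x01: "0 \<le> x j" "x j \<le> 1" if "j \<le> N" for j
    using x_mono[of 0 j] x_mono[of j N] x_0 x_N that by auto
  have b_hi: "0 < b_hi" using bnd[OF u[of 0]] b_lo by auto
  obtain p where p: "\<And>t. t \<in> {0..1/\<epsilon>} \<Longrightarrow>
        ((\<lambda>t. u (\<epsilon> * t)) has_real_derivative p t) (at t within {0..1/\<epsilon>})"
      "\<And>t. t \<in> {0..1/\<epsilon>} \<Longrightarrow> 0 \<le> p t \<and> p t \<le> K * exp (- (m * t\<^sup>2))"
      "\<And>t. t \<in> {0..1/\<epsilon>} \<Longrightarrow> U_hi - u (\<epsilon> * t) \<le> K * exp (- (m * t\<^sup>2))"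
    using prof unfolding layer_profile_def by blast
  \<comment> \<open>The stencil of the first outer row starts at \<open>layer_end - 1\<close>,
    inside the layer; this is why only half of \<open>\<alpha> * ln (real N)\<close> is
    available.\<close>
  have far: "\<alpha> * ln (real N) / 2 \<le> x j / \<epsilon>" if "i - 1 \<le> j" "j \<le> N" for j
  proof -
    have "\<epsilon> * (\<alpha> * ln (real N) / 2) \<le> x (layer_end - 1)"
      using x_before_layer_end by (simp add: mult_ac)
    also have "\<dots> \<le> x j" using x_mono[of "layer_end - 1" j] that i by simp
    finally show ?thesis using \<epsilon> by (simp add: pos_le_divide_eq mult_ac)
  qed
  have small: "K * exp (- (m * t\<^sup>2)) \<le> K * E" if "\<alpha> * ln (real N) / 2 \<le> t" for t
  proof -
    have "0 \<le> ln (real N)" using N_ge by simp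
    then have "(\<alpha> * ln (real N) / 2)\<^sup>2 \<le> t\<^sup>2" using that \<alpha> by (intro power_mono) auto
    then have "m * (\<alpha> * ln (real N) / 2)\<^sup>2 \<le> m * t\<^sup>2" using m by (rule mult_left_mono)
    then show ?thesis using K unfolding E_def
      by (intro mult_left_mono) (auto simp: power_mult_distrib power_divide)
  qed
  have mem: "x j / \<epsilon> \<in> {0..1/\<epsilon>}" if "j \<le> N" for j
    using x01[OF that] \<epsilon> by (simp add: divide_right_mono)
  have Fb: "\<bar>F (u (x j))\<bar> \<le> b_hi * (K * E)" if j: "i - 1 \<le> j" "j \<le> N" for j
  proof -
    have U: "u (x j) \<in> {U_lo..U_hi}" using u x01[OF j(2)] by simp
    then have "U_hi \<in> {U_lo..U_hi}" by simp
    from flux_x_difference_quotient[OF cont bnd U this, of 0] obtain \<beta> where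
      \<beta>: "b_lo \<le> \<beta>" "\<beta> \<le> b_hi" "F (u (x j)) = \<beta> * (u (x j) - U_hi)"
      by (auto simp: F_def flux_x_endpoint)
    have "u (\<epsilon> * (x j / \<epsilon>)) = u (x j)" using \<epsilon> by simp
    then have "U_hi - u (x j) \<le> K * E"
      using p(3)[OF mem[OF j(2)]] small[OF far[OF j]] by simp
    then have "\<beta> * (U_hi - u (x j)) \<le> b_hi * (K * E)"
      using \<beta> b_lo U by (intro mult_mono) auto
    moreover have "\<bar>F (u (x j))\<bar> = \<beta> * (U_hi - u (x j))"
      using \<beta> b_lo U by (simp add: abs_mult)
    ultimately show ?thesis by simp
  qed
  have slope: "\<bar>(u (x (Suc j)) - u (x j)) / step x (Suc j)\<bar> \<le> K * E / \<epsilon>"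
    if j: "i - 1 \<le> j" "Suc j \<le> N" for j
  proof -
    have st: "0 < step x (Suc j)" using step_pos[of "Suc j"] j by simp
    then have lt: "x j / \<epsilon> < x (Suc j) / \<epsilon>" using \<epsilon> by (simp add: step_def divide_strict_right_mono)
    have jN: "j \<le> N" using j by simp
    obtain r where r: "x j / \<epsilon> < r" "r < x (Suc j) / \<epsilon>"
      "u (\<epsilon> * (x (Suc j) / \<epsilon>)) - u (\<epsilon> * (x j / \<epsilon>)) = p r * (x (Suc j) / \<epsilon> - x j / \<epsilon>)"
      by (rule mean_value_within[OF p(1) _ lt]) (use mem[OF jN] mem[OF j(2)] in auto)
    have "r \<in> {0..1/\<epsilon>}" using r mem[OF jN] mem[OF j(2)] by auto
    then have pr: "0 \<le> p r" "p r \<le> K * E"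
      using p(2)[of r] small[of r] far[OF j(1) jN] r by auto
    have "u (x (Suc j)) - u (x j) = p r / \<epsilon> * step x (Suc j)"
      using r(3) \<epsilon> by (simp add: step_def diff_divide_distrib right_diff_distrib)
    then have "(u (x (Suc j)) - u (x j)) / step x (Suc j) = p r / \<epsilon>" using st by simp
    then show ?thesis using pr \<epsilon> by (simp add: divide_right_mono)
  qed
  have steps: "0 < step x i" "step x i \<le> 1" "0 < step x (i + 1)" "step x (i + 1) \<le> 1"
    using step_pos[of i] step_pos[of "i + 1"] x01[of i] x01[of "i - 1"] x01[of "i + 1"] iN
    by (auto simp: step_def)
  have chi: "0 < chi n N x i" "chi n N x i \<le> 3 / 2"
    using steps by (auto simp: chi_def avg_step_def)
  have nz: "chi n N x i \<noteq> 0" "step x (i + 1) \<noteq> 0" "avg_step x i \<noteq> 0"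
    using chi steps by (auto simp: avg_step_def)
  have KE: "0 \<le> b_hi * (K * E)" using K b_hi by (simp add: E_def)
  have w: "\<bar>a * y * F (u (x j))\<bar> \<le> d * (b_hi * (K * E))"
    if "0 \<le> a" "a \<le> d" "i - 1 \<le> j" "j \<le> N" "0 \<le> y" "y \<le> 1" for a d y j
  proof -
    have "\<bar>a * y * F (u (x j))\<bar> = a * y * \<bar>F (u (x j))\<bar>" using that by (simp add: abs_mult)
    also have "\<dots> \<le> (d * 1) * (b_hi * (K * E))"
      using that KE Fb[of j] by (intro mult_mono) auto
    finally show ?thesis by simp
  qed
  have D: "\<bar>\<epsilon>\<^sup>2 * ((u (x i) - u (x (i - 1))) / step x i + (u (x i) - u (x (i + 1))) / step x (i + 1))\<bar>
      \<le> 2 * (K * E)"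
  proof -
    have s1: "\<bar>(u (x i) - u (x (i - 1))) / step x i\<bar> \<le> K * E / \<epsilon>"
      using slope[of "i - 1"] iN by simp
    have s2: "\<bar>(u (x i) - u (x (i + 1))) / step x (i + 1)\<bar> \<le> K * E / \<epsilon>"
      using slope[of i] iN abs_minus_commute[of "u (x i)" "u (x (i + 1))"] by (simp add: abs_divide)
    have "\<bar>(u (x i) - u (x (i - 1))) / step x i + (u (x i) - u (x (i + 1))) / step x (i + 1)\<bar>
        \<le> 2 * (K * E / \<epsilon>)"
      using abs_triangle_ineq[of "(u (x i) - u (x (i - 1))) / step x i"
          "(u (x i) - u (x (i + 1))) / step x (i + 1)"] s1 s2 by linarith
    then have "\<bar>\<epsilon>\<^sup>2 * ((u (x i) - u (x (i - 1))) / step x i + (u (x i) - u (x (i + 1))) / step x (i + 1))\<bar>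
        \<le> \<epsilon>\<^sup>2 * (2 * (K * E / \<epsilon>))"
      by (simp only: abs_mult abs_power2) (intro mult_left_mono, auto)
    also have "\<dots> = 2 * (K * E) * \<epsilon>" using \<epsilon> by (simp add: power2_eq_square)
    also have "\<dots> \<le> 2 * (K * E) * 1" using \<epsilon>1 K by (intro mult_left_mono) (auto simp: E_def)
    finally show ?thesis by simp
  qed
  have w1: "\<bar>flux_next n N i * x (i + 1) * F (u (x (i + 1)))\<bar> \<le> 1 * (b_hi * (K * E))"
    by (rule w) (use x01[of "i + 1"] iN in \<open>auto simp: flux_next_def\<close>)
  have w2: "\<bar>flux_here n N i * x i * F (u (x i))\<bar> \<le> 1 * (b_hi * (K * E))"
    by (rule w) (use x01[of i] iN in \<open>auto simp: flux_here_def\<close>)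
  have w3: "\<bar>flux_prev n N i * x (i - 1) * F (u (x (i - 1)))\<bar> \<le> 1 / 2 * (b_hi * (K * E))"
    by (rule w) (use x01[of "i - 1"] iN in \<open>auto simp: flux_prev_def\<close>)
  have w4: "\<bar>source_here n N x i * 1 * F (u (x i))\<bar> \<le> 3 / 2 * (b_hi * (K * E))"
    by (rule w) (use chi steps iN in \<open>auto simp: source_here_def\<close>)
  have w5: "\<bar>source_next n N x i * 1 * F (u (x (i + 1)))\<bar> \<le> 1 / 2 * (b_hi * (K * E))"
    by (rule w) (use chi steps iN in \<open>auto simp: source_next_def\<close>)
  have tri: "\<bar>a - (d1 - d2 - d3) + d4 + d5\<bar> \<le> \<bar>a\<bar> + \<bar>d1\<bar> + \<bar>d2\<bar> + \<bar>d3\<bar> + \<bar>d4\<bar> + \<bar>d5\<bar>"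
    for a d1 d2 d3 d4 d5 :: real by linarith
  have "\<bar>chi n N x i * T_op b U_hi \<epsilon> n N x (\<lambda>i. u (x i)) i\<bar>
      \<le> 2 * (K * E) + 1 * (b_hi * (K * E)) + 1 * (b_hi * (K * E)) + 1 / 2 * (b_hi * (K * E))
        + 3 / 2 * (b_hi * (K * E)) + 1 / 2 * (b_hi * (K * E))"
    unfolding chi_T_op[OF nz] F_def[symmetric]
    by (rule order_trans[OF tri], intro add_mono D w1 w2 w3 w4[unfolded mult_1_right] w5[unfolded mult_1_right])
  also have "\<dots> \<le> 2 * (K * E) + 5 * (b_hi * (K * E))" using KE by linarith
  also have "\<dots> = (2 + 5 * b_hi) * K * E" by (simp add: algebra_simps)
  finally show ?thesis by (simp add: E_def)
qed

text \<open>A crude bound, sufficient for the finitely many \<open>N\<close> below the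
  threshold.\<close>

lemma norm_H_le_trivial:
  fixes z :: "nat \<Rightarrow> real"
  assumes "\<And>i. i \<in> {1..N-1} \<Longrightarrow> \<bar>z i\<bar> \<le> D" and "0 \<le> D"
  shows "norm_H n N x z \<le> 2 * D * real N"
proof -
  have x01: "0 \<le> x j" "x j \<le> 1" if "j \<le> N" for j
    using x_mono[of 0 j] x_mono[of j N] x_0 x_N that by auto
  have "norm_H n N x z \<le> (\<Sum>i=1..N-1. 2 * D)"
    unfolding norm_H_def
  proof (intro sum_mono mult_mono)
    fix i assume i: "i \<in> {1..N-1}"
    then have "i \<le> N" "i - 1 \<le> N" "Suc i \<le> N" "1 \<le> i" by auto
    then have "0 < step x i" "step x i \<le> 1" "0 < step x (Suc i)" "step x (Suc i) \<le> 1"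
      using step_pos[of i] step_pos[of "Suc i"] x01[of i] x01[of "i - 1"] x01[of "Suc i"]
      by (auto simp: step_def)
    then show "chi n N x i \<le> 2" by (auto simp: chi_def avg_step_def)
  qed (use assms in auto)
  also have "\<dots> = 2 * D * real (N - 1)" by simp
  also have "\<dots> \<le> 2 * D * real N" using assms(2) by (intro mult_left_mono) auto
  finally show ?thesis .
qed

end

section \<open>Thresholds for \<open>N\<close> and the final estimate\<close>

lemma ln_power_div_tendsto_0: "((\<lambda>y. ln y ^ k / y) \<longlongrightarrow> (0::real)) at_top"
proof -
  have "((\<lambda>y. ln y ^ k / exp (ln y)) \<longlongrightarrow> (0::real)) at_top"
    using filterlim_compose[OF tendsto_power_div_exp_0 ln_at_top] .
  moreover have "\<forall>\<^sub>F y in at_top. ln y ^ k / exp (ln y) = ln y ^ k / (y::real)"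
    using eventually_gt_at_top[of "0::real"] by eventually_elim simp
  ultimately show ?thesis by (rule Lim_transform_eventually)
qed

text \<open>The conditions serve, in this order, \<open>layer_steps\<close>, scaled layer steps of
  at most 1, a mesh ratio of at most 1 at \<open>layer_end\<close>, and a tail with enough short
  steps for the growing weights of the stability proof.\<close>

lemma fine_mesh_threshold:
  fixes \<alpha> b_hi c C :: real
  obtains N0 :: nat where "1 \<le> N0" and
    "\<And>N. N0 \<le> N \<Longrightarrow> 1 \<le> iter_ln l (real N) \<and> c * \<alpha> * ln (real N) / real N \<le> 1 \<and>
       b_hi * c * \<alpha>\<^sup>2 * (ln (real N))\<^sup>2 / (2 * real N) \<le> 1 \<and> C \<le> real N"
proof -
  have small: "\<forall>\<^sub>F y in at_top. a * (ln y ^ k / y) < 1" for a :: real and k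
    using order_tendstoD(2)[OF tendsto_mult_right_zero[OF ln_power_div_tendsto_0], of 1 a k] by simp
  have "\<forall>\<^sub>F y in at_top. 1 \<le> iter_ln l y"
    using filterlim_iter_ln[of l] by (simp add: filterlim_at_top)
  then have "\<forall>\<^sub>F y in at_top. 1 \<le> iter_ln l y \<and> c * \<alpha> * ln y / y \<le> 1 \<and>
      b_hi * c * \<alpha>\<^sup>2 * (ln y)\<^sup>2 / (2 * y) \<le> 1 \<and> C \<le> y"
    using small[of "c * \<alpha>" 1] small[of "b_hi * c * \<alpha>\<^sup>2 / 2" 2] eventually_ge_at_top[of C]
    by eventually_elim (auto simp: mult_ac)
  then have "\<forall>\<^sub>F N in sequentially. 1 \<le> iter_ln l (real N) \<and> c * \<alpha> * ln (real N) / real N \<le> 1 \<and>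
      b_hi * c * \<alpha>\<^sup>2 * (ln (real N))\<^sup>2 / (2 * real N) \<le> 1 \<and> C \<le> real N"
    using filterlim_real_sequentially unfolding filterlim_iff by blast
  then obtain N1 where N1: "\<And>N. N1 \<le> N \<Longrightarrow> 1 \<le> iter_ln l (real N) \<and>
      c * \<alpha> * ln (real N) / real N \<le> 1 \<and>
      b_hi * c * \<alpha>\<^sup>2 * (ln (real N))\<^sup>2 / (2 * real N) \<le> 1 \<and> C \<le> real N"
    unfolding eventually_sequentially by blast
  show ?thesis by (rule that[of "max 1 N1"]) (simp, rule N1, simp)
qed

lemma powr_neg_ln:
  fixes y :: real
  assumes "0 < y"
  shows "y powr (- (1 + \<eta> * ln y)) = exp (- (ln y + \<eta> * (ln y)\<^sup>2))"
  using assms by (simp add: powr_def algebra_simps power2_eq_square)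

text \<open>After taking logarithms this is
  \<open>2 * ln y \<le> 1 / \<eta> + \<eta> * (ln y)\<^sup>2\<close>, a completed square: half of
  the Gaussian exponent absorbs two powers of \<open>y\<close>.\<close>

lemma exp_neg_ln_square_le:
  fixes \<eta> y :: real
  assumes "0 < \<eta>" "0 < y"
  shows "y * exp (- (2 * \<eta> * (ln y)\<^sup>2)) \<le> exp (1 / \<eta>) * y powr (- (1 + \<eta> * ln y))"
proof -
  have "1 / \<eta> - (ln y + \<eta> * (ln y)\<^sup>2) - (ln y - 2 * \<eta> * (ln y)\<^sup>2) = \<eta> * (ln y - 1 / \<eta>)\<^sup>2"
    using assms by (simp add: power2_eq_square field_simps)
  moreover have "0 \<le> \<eta> * (ln y - 1 / \<eta>)\<^sup>2" using assms by simp
  ultimately have "ln y - 2 * \<eta> * (ln y)\<^sup>2 \<le> 1 / \<eta> - (ln y + \<eta> * (ln y)\<^sup>2)" by linarith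
  then have "exp (ln y - 2 * \<eta> * (ln y)\<^sup>2) \<le> exp (1 / \<eta> - (ln y + \<eta> * (ln y)\<^sup>2))" by simp
  moreover have "exp (ln y - 2 * \<eta> * (ln y)\<^sup>2) = y * exp (- (2 * \<eta> * (ln y)\<^sup>2))"
    using assms by (simp add: exp_diff exp_minus divide_inverse)
  moreover have "exp (1 / \<eta> - (ln y + \<eta> * (ln y)\<^sup>2)) = exp (1 / \<eta>) * exp (- (ln y + \<eta> * (ln y)\<^sup>2))"
    by (simp only: exp_add[symmetric] diff_conv_add_uminus)
  ultimately show ?thesis unfolding powr_neg_ln[OF assms(2)] by simp
qed

theorem theorem3:
  fixes b :: "real \<Rightarrow> real" and U_lo U_hi b_lo b_hi \<alpha> c :: real and l :: nat
  assumes "U_lo < U_hi"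
    and "C_k_on 3 b {U_lo..U_hi}"
    and "0 < b_lo"
    and "\<And>v. v \<in> {U_lo..U_hi} \<Longrightarrow> b_lo \<le> b v \<and> b v \<le> b_hi"
    and "1 \<le> l" and "0 < \<alpha>" and "1 \<le> c"
  shows "\<exists>\<epsilon>\<^sub>0 \<eta> M :: real. 0 < \<epsilon>\<^sub>0 \<and> \<epsilon>\<^sub>0 < 1 \<and> 0 < \<eta> \<and> 0 < M \<and>
    (\<forall>\<epsilon> N x u w.
       0 < \<epsilon> \<and> \<epsilon> \<le> \<epsilon>\<^sub>0 \<and> S_mesh \<alpha> l c \<epsilon> N x \<and>
       bvp_solution b U_lo U_hi \<epsilon> u \<and> discrete_solution b U_lo U_hi b_hi \<epsilon> N x w \<longrightarrow>
       norm_H (switch_index b_hi \<epsilon> N x) N x (\<lambda>i. w i - u (x i))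
         \<le> M * (\<epsilon> * (iter_ln l (real N) / real N)\<^sup>2
                + real N powr (- (1 + \<eta> * ln (real N)))))"
proof -
  note bnd = assms(4)
  have cont: "continuous_on {U_lo..U_hi} b" using assms(2) by (rule C_k_on_imp_continuous_on)
  have b_hi: "0 < b_hi" using bnd[of U_lo] assms(1,3) by auto
  obtain K where K: "0 < K" and profile:
    "\<And>\<epsilon> u. \<lbrakk>0 < \<epsilon>; \<epsilon> \<le> 1; bvp_solution b U_lo U_hi \<epsilon> u\<rbrakk> \<Longrightarrow>
       layer_profile (flux_x b U_hi 0) U_hi (4 / \<alpha> + 1) (b_lo / 4) K (1 / \<epsilon>) (\<lambda>t. u (\<epsilon> * t))"
    by (rule layer_profile_exists[OF assms(1-3) bnd]) auto
  have "0 < b_lo / (8 * b_hi)" "(2 * b_hi - b_lo) / (2 * b_hi + b_lo) < 1"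
    using assms(3) b_hi by (simp_all add: field_simps)
  \<comment> \<open>\<open>m\<close> determines over how many rows next to \<open>x = 1\<close> the
    stability weights grow; it depends on \<open>b_lo\<close> and \<open>b_hi\<close> only.\<close>
  then obtain m where m: "((2 * b_hi - b_lo) / (2 * b_hi + b_lo)) ^ m < b_lo / (8 * b_hi)"
    using real_arch_pow_inv by blast
  \<comment> \<open>The outer rows decay with the coefficient
    \<open>b_lo / 4 * \<alpha>\<^sup>2 / 4\<close> of \<open>(ln (real N))\<^sup>2\<close>, which is
    \<open>2 * \<eta>\<close>.\<close>
  define \<eta> where "\<eta> = b_lo * \<alpha>\<^sup>2 / 32"
  have \<eta>: "0 < \<eta>" using assms(3,6) by (simp add: \<eta>_def)
  obtain N0 where N0: "1 \<le> N0" and fine: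
    "\<And>N. N0 \<le> N \<Longrightarrow> 1 \<le> iter_ln l (real N) \<and> c * \<alpha> * ln (real N) / real N \<le> 1 \<and>
       b_hi * c * \<alpha>\<^sup>2 * (ln (real N))\<^sup>2 / (2 * real N) \<le> 1 \<and> 4 * c * real (m + 3) \<le> real N"
    by (rule fine_mesh_threshold) auto
  define M1 where "M1 = 8 / b_lo * (K * (c * \<alpha>)\<^sup>2 * (2 + 2 * real l))"
  define M2 where "M2 = 8 / b_lo * ((2 + 5 * b_hi) * K * exp (1 / \<eta>))"
  \<comment> \<open>For \<open>N\<close> below \<open>N0\<close> the exponential is an upper bound
    for the reciprocal of \<open>real N powr (- (1 + \<eta> * ln (real N)))\<close>.\<close>
  define M3 where "M3 = 2 * (U_hi - U_lo) * real N0 * exp (ln (real N0) + \<eta> * (ln (real N0))\<^sup>2)"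
  have M: "0 < M1" "0 < M2" "0 < M3"
    using assms K b_hi N0 by (auto simp: M1_def M2_def M3_def intro!: mult_pos_pos add_pos_nonneg divide_pos_pos)
  define M where "M = M1 + M2 + M3"
  have "norm_H (switch_index b_hi \<epsilon> N x) N x (\<lambda>i. w i - u (x i))
      \<le> M * (\<epsilon> * (iter_ln l (real N) / real N)\<^sup>2 + real N powr (- (1 + \<eta> * ln (real N))))"
    if \<epsilon>: "0 < \<epsilon>" "\<epsilon> \<le> 1 / 2" and mesh: "S_mesh \<alpha> l c \<epsilon> N x"
      and u: "bvp_solution b U_lo U_hi \<epsilon> u" and w: "discrete_solution b U_lo U_hi b_hi \<epsilon> N x w"
    for \<epsilon> N x u w
  proof -
    have \<epsilon>1: "\<epsilon> \<le> 1" using \<epsilon>(2) by simp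
    obtain Ns where "S_mesh_blocks \<alpha> c \<epsilon> l N x Ns"
      using S_mesh_imp_blocks[OF mesh assms(6,7) \<epsilon>(1)] by blast
    then interpret S_mesh_blocks \<alpha> c \<epsilon> l N x Ns .
    define n where "n = switch_index b_hi \<epsilon> N x"
    define \<delta> where "\<delta> = \<epsilon> * (iter_ln l (real N) / real N)\<^sup>2"
    define \<rho> where "\<rho> = real N powr (- (1 + \<eta> * ln (real N)))"
    have nonneg: "0 \<le> \<delta>" "0 \<le> \<rho>" using \<epsilon> by (simp_all add: \<delta>_def \<rho>_def)
    have Npos: "0 < real N" using N_ge by simp
    have x01: "x i \<in> {0..1}" if "i \<le> N" for i
      using x_mono[of 0 i] x_mono[of i N] x_0 x_N that by auto
    have uU: "u y \<in> {U_lo..U_hi}" if "y \<in> {0..1}" for y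
      using u that unfolding bvp_solution_def by blast
    have w_bd: "w 0 = U_lo" "w N = U_hi" and w_int: "\<And>i. i \<in> {1..N-1} \<Longrightarrow> w i \<in> {U_lo..U_hi}"
      and Tw: "\<And>i. i \<in> {1..N-1} \<Longrightarrow> T_op b U_hi \<epsilon> n N x w i = 0"
      using w unfolding discrete_solution_def n_def by auto
    have wU: "w i \<in> {U_lo..U_hi}" if "i \<le> N" for i
    proof -
      have "i = 0 \<or> i = N \<or> i \<in> {1..N-1}" using that by auto
      then show ?thesis using w_bd w_int assms(1) by (elim disjE) auto
    qed
    have bd: "w 0 = u (x 0)" "w N = u (x N)"
      using w_bd u x_0 x_N unfolding bvp_solution_def by auto
    have "norm_H n N x (\<lambda>i. w i - u (x i)) \<le> M * (\<delta> + \<rho>)"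
    proof (cases "N0 \<le> N")
      case False
      have "norm_H n N x (\<lambda>i. w i - u (x i)) \<le> 2 * (U_hi - U_lo) * real N"
      proof (rule norm_H_le_trivial)
        fix i assume "i \<in> {1..N-1}"
        then have "i \<le> N" by auto
        then show "\<bar>w i - u (x i)\<bar> \<le> U_hi - U_lo" using wU[of i] uU[OF x01[of i]] by auto
      qed (use assms(1) in simp)
      also have "\<dots> \<le> 2 * (U_hi - U_lo) * real N0" using False assms(1) by (intro mult_left_mono) auto
      also have "\<dots> \<le> M3 * \<rho>"
      proof -
        have ln: "0 \<le> ln (real N)" "ln (real N) \<le> ln (real N0)" using False N_ge by auto
        then have "\<eta> * (ln (real N))\<^sup>2 \<le> \<eta> * (ln (real N0))\<^sup>2"
          using \<eta> by (intro mult_left_mono power_mono) auto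
        then have "1 \<le> exp (ln (real N0) + \<eta> * (ln (real N0))\<^sup>2) * \<rho>"
          unfolding \<rho>_def powr_neg_ln[OF Npos] exp_add[symmetric] using ln by simp
        then have "2 * (U_hi - U_lo) * real N0 * 1
            \<le> 2 * (U_hi - U_lo) * real N0 * (exp (ln (real N0) + \<eta> * (ln (real N0))\<^sup>2) * \<rho>)"
          using assms(1) by (intro mult_left_mono) auto
        then show ?thesis by (simp add: M3_def mult_ac)
      qed
      also have "\<dots> \<le> M * (\<delta> + \<rho>)"
        using M nonneg by (intro mult_mono) (auto simp: M_def)
      finally show ?thesis .
    next
      case True
      note fineN = fine[OF True]
      note sw = switch_index_facts[OF less_imp_le[OF b_hi], folded n_def]
      \<comment> \<open>This makes all rows before \<open>layer_end\<close> central, as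
        \<open>layer_consistency\<close> requires.\<close>
      have I: "layer_end \<le> n"
      proof (rule sw(4))
        have "x (layer_end - 1) * step x layer_end
            \<le> (\<alpha> * \<epsilon> * ln (real N)) * (c * (\<alpha> * \<epsilon> * ln (real N)) / real N)"
          using x_mono[of "layer_end - 1" layer_end] x_mono[of 0 "layer_end - 1"] x_mono[of 0 layer_end] x_0 x_layer_end
            step_layer_le[of layer_end] step_pos[of layer_end] layer_end_bounds
          by (intro mult_mono) auto
        then have "b_hi * (x (layer_end - 1) * step x layer_end)
            \<le> b_hi * ((\<alpha> * \<epsilon> * ln (real N)) * (c * (\<alpha> * \<epsilon> * ln (real N)) / real N))"
          using b_hi by (intro mult_left_mono) auto
        then have "mesh_ratio b_hi \<epsilon> x layer_end \<le>
            b_hi * ((\<alpha> * \<epsilon> * ln (real N)) * (c * (\<alpha> * \<epsilon> * ln (real N)) / real N)) / (2 * \<epsilon>\<^sup>2)"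
          unfolding mesh_ratio_def by (intro divide_right_mono) (auto simp: mult.assoc)
        also have "\<dots> = b_hi * c * \<alpha>\<^sup>2 * (ln (real N))\<^sup>2 / (2 * real N)"
          using \<epsilon> by (simp add: power2_eq_square field_simps)
        finally show "mesh_ratio b_hi \<epsilon> x layer_end \<le> 1" using fineN by simp
      qed (use layer_end_bounds in auto)
      have tail: "layer_end + m + 3 \<le> N"
      proof -
        have "c * real (m + 3) \<le> c * (real N - real layer_end)"
          using tail_length fineN assms(7) by (simp add: algebra_simps)
        then have "real (m + 3) \<le> real N - real layer_end" using assms(7) by simp
        then show ?thesis by linarith
      qed
      have unif: "step x j = step x N" if "N - 2 - m \<le> j" "j \<le> N" for j
        using step_tail(1)[of j] that tail by simp
      have h: "real (m + 2) * step x N \<le> 1 / 4"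
      proof -
        have "real (m + 2) * step x N \<le> real (m + 2) * (c / real N)"
          using step_tail(2)[of N] tail by (intro mult_left_mono) auto
        also have "\<dots> \<le> 1 / 4" using fineN assms(7) Npos by (simp add: field_simps)
        finally show ?thesis .
      qed
      have mN: "m + 3 \<le> N" using tail by simp
      have ux: "u (x i) \<in> {U_lo..U_hi}" if "i \<le> N" for i using uU x01 that by blast
      let ?r = "\<lambda>i. \<bar>chi n N x i * T_op b U_hi \<epsilon> n N x (\<lambda>i. u (x i)) i\<bar>"
      have "norm_H n N x (\<lambda>i. w i - u (x i))
          \<le> 8 / b_lo * (\<Sum>i=1..N-1. \<bar>chi n N x i *
              (T_op b U_hi \<epsilon> n N x w i - T_op b U_hi \<epsilon> n N x (\<lambda>i. u (x i)) i)\<bar>)"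
        by (rule stability[OF cont assms(3) bnd less_imp_le[OF m] \<epsilon> mN sw(1,2) x_0 x_N step_pos
              sw(3) unif h wU ux bd])
      also have "(\<Sum>i=1..N-1. \<bar>chi n N x i *
              (T_op b U_hi \<epsilon> n N x w i - T_op b U_hi \<epsilon> n N x (\<lambda>i. u (x i)) i)\<bar>) = (\<Sum>i=1..N-1. ?r i)"
        using Tw by (intro sum.cong) (auto simp: abs_mult)
      finally have stab: "norm_H n N x (\<lambda>i. w i - u (x i)) \<le> 8 / b_lo * (\<Sum>i=1..N-1. ?r i)" .
      have "(\<Sum>i=1..N-1. ?r i) = (\<Sum>i=1..<layer_end. ?r i) + (\<Sum>i=layer_end..<N. ?r i)"
      proof -
        have "{1..N-1} = {1..<N}" by auto
        then show ?thesis using layer_end_bounds by (simp add: sum.atLeastLessThan_concat)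
      qed
      also have "\<dots> \<le> K * (c * \<alpha>)\<^sup>2 * (2 + 2 * real l) * \<delta> + (2 + 5 * b_hi) * K * exp (1 / \<eta>) * \<rho>"
      proof (rule add_mono)
        have "(\<Sum>i=1..<layer_end. ?r i)
            \<le> \<epsilon> * (K * (c * \<alpha> * iter_ln l (real N) / real N)\<^sup>2 * (2 + 2 * real l))"
          by (rule layer_consistency[OF profile[OF \<epsilon> \<epsilon>1 u]]) (use K \<epsilon> fineN I sw in auto)
        then show "(\<Sum>i=1..<layer_end. ?r i) \<le> K * (c * \<alpha>)\<^sup>2 * (2 + 2 * real l) * \<delta>"
          by (simp add: \<delta>_def power_mult_distrib power_divide mult_ac)
        have "(\<Sum>i=layer_end..<N. ?r i)
            \<le> (\<Sum>i=layer_end..<N. (2 + 5 * b_hi) * K * exp (- (b_lo / 4 * \<alpha>\<^sup>2 / 4 * (ln (real N))\<^sup>2)))"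
          by (intro sum_mono outer_consistency[OF profile[OF \<epsilon> \<epsilon>1 u] _ _ _ cont assms(3) bnd uU])
             (use K \<epsilon>1 assms(3) in auto)
        also have "\<dots> = (2 + 5 * b_hi) * K *
            (real (N - layer_end) * exp (- (2 * \<eta> * (ln (real N))\<^sup>2)))"
          by (simp add: \<eta>_def)
        also have "\<dots> \<le> (2 + 5 * b_hi) * K * (real N * exp (- (2 * \<eta> * (ln (real N))\<^sup>2)))"
          using K b_hi by (intro mult_left_mono mult_right_mono) auto
        also have "\<dots> \<le> (2 + 5 * b_hi) * K * (exp (1 / \<eta>) * \<rho>)"
          unfolding \<rho>_def using K b_hi exp_neg_ln_square_le[OF \<eta> Npos] by (intro mult_left_mono) auto
        finally show "(\<Sum>i=layer_end..<N. ?r i) \<le> (2 + 5 * b_hi) * K * exp (1 / \<eta>) * \<rho>"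
          by (simp add: mult_ac)
      qed
      finally have "8 / b_lo * (\<Sum>i=1..N-1. ?r i) \<le> 8 / b_lo *
          (K * (c * \<alpha>)\<^sup>2 * (2 + 2 * real l) * \<delta> + (2 + 5 * b_hi) * K * exp (1 / \<eta>) * \<rho>)"
        using assms(3) by (intro mult_left_mono) auto
      also have "\<dots> = M1 * \<delta> + M2 * \<rho>" by (simp add: M1_def M2_def algebra_simps)
      finally have "norm_H n N x (\<lambda>i. w i - u (x i)) \<le> M1 * \<delta> + M2 * \<rho>"
        using stab by linarith
      also have "\<dots> \<le> M * \<delta> + M * \<rho>"
        using M nonneg by (intro add_mono mult_right_mono) (auto simp: M_def)
      finally show ?thesis by (simp add: distrib_left)
    qed
    then show ?thesis by (simp add: n_def \<delta>_def \<rho>_def)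
  qed
  then show ?thesis using \<eta> M
    \<comment> \<open>The value \<open>1 / 2\<close> is a free choice below 1: smallness of
      \<epsilon> enters the argument only as \<open>\<epsilon> \<le> 1\<close>.\<close>
    by (intro exI[of _ "1 / 2"] exI[of _ \<eta>] exI[of _ M]) (auto simp: M_def)
qed

end
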